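(* Let $0<\alpha<1$, $1<p<1/\alpha$ and $1/q=1/p-\alpha$. Let $w$ be a nonnegative measurable function on $\mathbb{R}$ such that $w^p$ and $w^{-p'}$ are locally integrable on $\mathbb{R}$, where $p'=p/(p-1)$. Assume that for all $f\in L^p(w^p)$, $W_\alpha f(x)<+\infty$ for almost every $x\in\mathbb{R}$. Then for all $f\in L^p(w^p)$, $$f(x)=\lim_{\varepsilon\to0^+}(D_{\rm right})^\alpha_\varepsilon(W_\alpha f)(x)\quad\text{for almost every }x\in\mathbb{R};$$ that is, $f(x)=(D_{\rm right})^\alpha(W_\alpha f)(x)$ for almost every $x\in\mathbb{R}$.
   Context: $L^p(w^p)=L^p(\mathbb{R},w(x)^p\,dx)$. The fractional integral is $W_\alpha f(x)=\frac{1}{\Gamma(\alpha)}\int_x^\infty\frac{f(t)}{(t-x)^{1-\alpha}}\,dt$. For nonnegative $f$ it takes values in $[0,\infty]$; the finiteness hypothesis is to be understood as finiteness a.e. of $W_\alpha f$ for all nonnegative $f\in L^p(w^p)$, equivalently a.e. absolute convergence of the integral for every $f\in L^p(w^p)$. For $\varepsilon>0$ the truncated fractional derivative from the right is $$(D_{\rm right})^\alpha_\varepsilon u(x)=\frac{1}{\Gamma(-\alpha)}\int_{x+\varepsilon}^\infty\frac{u(t)-u(x)}{(t-x)^{1+\alpha}}\,dt,$$ and $(D_{\rm right})^\alpha u=\lim_{\varepsilon\to0^+}(D_{\rm right})^\alpha_\varepsilon u$. *)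

theory Defs
  imports "HOL-Analysis.Analysis"
begin

definition Lp_space :: "'a measure \<Rightarrow> real \<Rightarrow> ('a \<Rightarrow> real) set" where
  "Lp_space M p = {f \<in> borel_measurable M. integrable M (\<lambda>x. \<bar>f x\<bar> powr p)}"

(* The measure w(x)^p dx on the Lebesgue sigma-algebra. *)
definition weight_measure :: "(real \<Rightarrow> real) \<Rightarrow> real \<Rightarrow> real measure" where
  "weight_measure w p = density lebesgue (\<lambda>x. ennreal (w x powr p))"

(* Local integrability of a function with values in [0, \<infinity>].  The extended codomain
   matters for negative powers of a weight: these are \<infinity> at zeros of the weight,
   whereas 0 powr a = 0 in the reals. *)
definition locally_integrable_ennreal :: "(real \<Rightarrow> ennreal) \<Rightarrow> bool" where
  "locally_integrable_ennreal g \<longleftrightarrow>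
     g \<in> borel_measurable lebesgue \<and>
     (\<forall>K. compact K \<longrightarrow> (\<integral>\<^sup>+x\<in>K. g x \<partial>lebesgue) < \<infinity>)"

(* W_\<alpha> f for nonnegative f, as a function with values in [0, \<infinity>]. *)
definition frac_integral_ennreal :: "real \<Rightarrow> (real \<Rightarrow> real) \<Rightarrow> real \<Rightarrow> ennreal" where
  "frac_integral_ennreal \<alpha> f x =
     ennreal (1 / Gamma \<alpha>) *
       (\<integral>\<^sup>+t\<in>{x<..}. ennreal (f t / (t - x) powr (1 - \<alpha>)) \<partial>lebesgue)"

(* W_\<alpha> f for signed f; meaningful at those x where the integral converges absolutely
   (elsewhere the Bochner integral is 0 by convention). *)
definition frac_integral :: "real \<Rightarrow> (real \<Rightarrow> real) \<Rightarrow> real \<Rightarrow> real" where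
  "frac_integral \<alpha> f x =
     1 / Gamma \<alpha> * (LINT t:{x<..}|lebesgue. f t / (t - x) powr (1 - \<alpha>))"

definition frac_deriv_integrand :: "real \<Rightarrow> (real \<Rightarrow> real) \<Rightarrow> real \<Rightarrow> real \<Rightarrow> real" where
  "frac_deriv_integrand \<alpha> u x t = (u t - u x) / (t - x) powr (1 + \<alpha>)"

definition frac_deriv_right_trunc ::
    "real \<Rightarrow> real \<Rightarrow> (real \<Rightarrow> real) \<Rightarrow> real \<Rightarrow> real" where
  "frac_deriv_right_trunc \<alpha> \<epsilon> u x =
     1 / Gamma (- \<alpha>) * (LINT t:{x + \<epsilon><..}|lebesgue. frac_deriv_integrand \<alpha> u x t)"

definition frac_deriv_right :: "real \<Rightarrow> (real \<Rightarrow> real) \<Rightarrow> real \<Rightarrow> real" where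
  "frac_deriv_right \<alpha> u x = Lim (at_right 0) (\<lambda>\<epsilon>. frac_deriv_right_trunc \<alpha> \<epsilon> u x)"

end

(*
  Write u = W_\<alpha> f with f \<ge> 0; the signed case follows by linearity.  Interchanging the
  integrations over t and s and evaluating the t-integral turns the truncated derivative at x into

    (D_right)^\<alpha>_\<epsilon> u(x) = 1 / (\<Gamma>(\<alpha>) \<Gamma>(1-\<alpha>)) \<integral>_{s>x} f(s) k((s-x)/\<epsilon>) / \<epsilon> ds,
    k(z) = z^(\<alpha>-1) - (z-1)_+^\<alpha> / z.

  The kernel k decreases to 0, so k(z) = \<integral>_{r>z} m(r) dr with m = -k' \<ge> 0, and a second interchange
  gives the integral of r m(r) A(\<epsilon> r) over r > 0, where A(h) is the mean of f over (x, x+h).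
  Finiteness of W_\<alpha> f at x makes A bounded; at Lebesgue points A(h) tends to f(x).  Dominated
  convergence and \<integral> r m(r) dr = B(\<alpha>, 1-\<alpha>) = \<Gamma>(\<alpha>) \<Gamma>(1-\<alpha>) conclude.

  Almost every point is a Lebesgue point because finiteness of W_\<alpha> f at x makes f integrable on
  bounded intervals to the right of x, where (s-x)^(\<alpha>-1) is bounded below.
*)
theory Submission
  imports Defs
begin


section \<open>Fundamental theorem of calculus for nonnegative integrands\<close>

text \<open>The gauge integral integrates every such derivative, and nonnegativity turns its value
  into a Lebesgue integral. The open interval admits singularities of \<open>f\<close> at the
  endpoints; \<open>S\<close> admits corners of \<open>F\<close>.\<close>

lemma nn_integral_FTC_Ioo:
  fixes f F :: "real \<Rightarrow> real"
  assumes "a \<le> b" "finite S" "continuous_on {a..b} F"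
    and deriv: "\<And>x. x \<in> {a<..<b} - S \<Longrightarrow> (F has_real_derivative f x) (at x)"
    and nonneg: "\<And>x. x \<in> {a<..<b} \<Longrightarrow> 0 \<le> f x"
  shows "(\<integral>\<^sup>+x\<in>{a<..<b}. ennreal (f x) \<partial>lborel) = ennreal (F b - F a)"
proof -
  have "(f has_integral (F b - F a)) {a..b}"
    using assms by (intro fundamental_theorem_of_calculus_interior_strong[where S=S])
      (auto simp: has_real_derivative_iff_has_vector_derivative)
  hence "(f has_integral (F b - F a)) {a<..<b}"
    by (simp add: has_integral_Icc_iff_Ioo)
  from nn_integral_has_integral_lebesgue[OF nonneg this]
  have "(\<integral>\<^sup>+x. ennreal (indicator {a<..<b} x * f x) \<partial>lborel) = ennreal (F b - F a)"
    by simp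
  also have "(\<integral>\<^sup>+x. ennreal (indicator {a<..<b} x * f x) \<partial>lborel) = (\<integral>\<^sup>+x\<in>{a<..<b}. ennreal (f x) \<partial>lborel)"
    by (intro nn_integral_cong) (auto split: split_indicator)
  finally show ?thesis .
qed

text \<open>Monotone convergence along the intervals from \<open>a\<close> to
  \<open>a + n\<close>.\<close>

lemma nn_integral_FTC_Ioi:
  fixes f F :: "real \<Rightarrow> real"
  assumes f: "f \<in> borel_measurable borel" and S: "finite S" and cont: "continuous_on {a..} F"
    and deriv: "\<And>x. x \<in> {a<..} - S \<Longrightarrow> (F has_real_derivative f x) (at x)"
    and nonneg: "\<And>x. a < x \<Longrightarrow> 0 \<le> f x"
    and lim: "(F \<longlongrightarrow> L) at_top"
  shows "(\<integral>\<^sup>+x\<in>{a<..}. ennreal (f x) \<partial>lborel) = ennreal (L - F a)"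
proof -
  have fin: "(\<integral>\<^sup>+x\<in>{a<..<a + real n}. ennreal (f x) \<partial>lborel) = ennreal (F (a + real n) - F a)" for n
    using S deriv nonneg by (intro nn_integral_FTC_Ioo[where S=S] continuous_on_subset[OF cont]) auto
  have "(\<lambda>n. \<integral>\<^sup>+x\<in>{a<..<a + real n}. ennreal (f x) \<partial>lborel) \<longlonglongrightarrow> (\<integral>\<^sup>+x\<in>{a<..}. ennreal (f x) \<partial>lborel)"
  proof (rule nn_integral_LIMSEQ)
    show "incseq (\<lambda>n x. ennreal (f x) * indicator {a<..<a + real n} x)"
      by (auto simp: incseq_def le_fun_def split: split_indicator)
    show "(\<lambda>n. ennreal (f x) * indicator {a<..<a + real n} x) \<longlonglongrightarrow> ennreal (f x) * indicator {a<..} x" for x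
    proof (rule tendsto_eventually)
      obtain N where "x - a < real N" using reals_Archimedean2 by blast
      thus "\<forall>\<^sub>F n in sequentially. ennreal (f x) * indicator {a<..<a + real n} x = ennreal (f x) * indicator {a<..} x"
        by (intro eventually_sequentiallyI[of N]) (auto split: split_indicator)
    qed
  qed (use f in measurable)
  moreover have "(\<lambda>n. ennreal (F (a + real n) - F a)) \<longlonglongrightarrow> ennreal (L - F a)"
  proof -
    have "filterlim (\<lambda>n. a + real n) at_top sequentially"
      by (intro filterlim_tendsto_add_at_top[OF tendsto_const] filterlim_real_sequentially)
    from filterlim_compose[OF lim this] show ?thesis
      by (intro tendsto_intros) auto
  qed
  ultimately show ?thesis
    unfolding fin by (rule LIMSEQ_unique)
qed

section \<open>The kernel k and its density m\<close>

text \<open>This is k of the overview; the truncated power vanishes for z \<le> 1 because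
  \<open>0 powr \<alpha> = 0\<close>.\<close>

definition frac_kernel :: "real \<Rightarrow> real \<Rightarrow> real" where
  "frac_kernel \<alpha> z = z powr (\<alpha> - 1) - max 0 (z - 1) powr \<alpha> / z"

text \<open>This is m = -k' away from the kink at 1. The case split keeps the base
  \<open>r - 1\<close> positive wherever it is raised to a power.\<close>

definition frac_kernel_density :: "real \<Rightarrow> real \<Rightarrow> real" where
  "frac_kernel_density \<alpha> r = (1 - \<alpha>) * r powr (\<alpha> - 2) +
     (if r \<le> 1 then 0 else \<alpha> * (r - 1) powr (\<alpha> - 1) / r - (r - 1) powr \<alpha> / r\<^sup>2)"

lemma measurable_frac_kernel [measurable]: "frac_kernel \<alpha> \<in> borel_measurable borel"
  unfolding frac_kernel_def by measurable

lemma measurable_frac_kernel_density [measurable]: "frac_kernel_density \<alpha> \<in> borel_measurable borel"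
  unfolding frac_kernel_density_def by measurable

text \<open>In this form \<open>r m(r)\<close> is a Beta density plus the derivative of
  \<open>((1 - \<alpha>) / \<alpha>) (r\<^sup>\<alpha> - (r - 1)\<^sub>+\<^sup>\<alpha>)\<close>, which vanishes at both ends.\<close>
lemma mult_frac_kernel_density:
  assumes "0 < r"
  shows "r * frac_kernel_density \<alpha> r = (1 - \<alpha>) * r powr (\<alpha> - 1) +
           (if r \<le> 1 then 0 else (r - 1) powr (\<alpha> - 1) / r - (1 - \<alpha>) * (r - 1) powr (\<alpha> - 1))"
proof -
  have 1: "r * r powr (\<alpha> - 2) = r powr (\<alpha> - 1)"
    using powr_mult_base[of r "\<alpha> - 2"] assms by simp
  have 2: "(r - 1) powr \<alpha> = (r - 1) * (r - 1) powr (\<alpha> - 1)" if "r > 1"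
    using powr_mult_base[of "r - 1" "\<alpha> - 1"] that by simp
  show ?thesis
  proof (cases "r \<le> 1")
    case True
    with 1 show ?thesis by (simp add: frac_kernel_density_def algebra_simps)
  next
    case False
    have "r * frac_kernel_density \<alpha> r = (1 - \<alpha>) * (r * r powr (\<alpha> - 2)) +
        r * (\<alpha> * (r - 1) powr (\<alpha> - 1) / r - (r - 1) powr \<alpha> / r\<^sup>2)"
      using False by (simp add: frac_kernel_density_def algebra_simps)
    also have "r * (\<alpha> * (r - 1) powr (\<alpha> - 1) / r - (r - 1) powr \<alpha> / r\<^sup>2) =
        (r - 1) powr (\<alpha> - 1) / r - (1 - \<alpha>) * (r - 1) powr (\<alpha> - 1)"
      unfolding 2[OF False[unfolded not_le]] using assms by (simp add: field_simps power2_eq_square)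
    finally show ?thesis using False 1 by simp
  qed
qed

text \<open>For r > 1, multiplication by r^2 turns m(r) into (1 - \<alpha>) (r^\<alpha> - (r -
  1)^\<alpha>) + \<alpha> (r - 1)^(\<alpha> - 1), whose terms are nonnegative because powers with
  positive exponent increase.\<close>

lemma frac_kernel_density_nonneg:
  assumes "0 < \<alpha>" "\<alpha> < 1" "0 < r"
  shows "0 \<le> frac_kernel_density \<alpha> r"
proof (cases "r \<le> 1")
  case False
  define P where "P = (r - 1) powr (\<alpha> - 1)"
  have 1: "r\<^sup>2 * r powr (\<alpha> - 2) = r powr \<alpha>"
    using assms by (simp add: powr_diff powr_numeral)
  have 2: "(r - 1) powr \<alpha> = (r - 1) * P"
    using powr_mult_base[of "r - 1" "\<alpha> - 1"] False by (simp add: P_def)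
  have "r\<^sup>2 * frac_kernel_density \<alpha> r =
      (1 - \<alpha>) * (r\<^sup>2 * r powr (\<alpha> - 2)) + r\<^sup>2 * (\<alpha> * P / r - (r - 1) * P / r\<^sup>2)"
    using False by (simp add: frac_kernel_density_def 2 P_def[symmetric] algebra_simps)
  also have "r\<^sup>2 * (\<alpha> * P / r - (r - 1) * P / r\<^sup>2) = \<alpha> * P - (1 - \<alpha>) * ((r - 1) * P)"
    using assms by (simp add: field_simps power2_eq_square)
  also have "(1 - \<alpha>) * (r\<^sup>2 * r powr (\<alpha> - 2)) + (\<alpha> * P - (1 - \<alpha>) * ((r - 1) * P)) =
      (1 - \<alpha>) * (r powr \<alpha> - (r - 1) powr \<alpha>) + \<alpha> * P"
    by (simp add: 1 2 algebra_simps)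
  also have "\<dots> \<ge> 0"
    using False assms by (intro add_nonneg_nonneg mult_nonneg_nonneg) (auto simp: P_def intro!: powr_mono2)
  finally show ?thesis using assms by (simp add: zero_le_mult_iff)
qed (use assms in \<open>simp add: frac_kernel_density_def\<close>)

lemma has_real_derivative_frac_kernel:
  assumes "0 < z" "z \<noteq> 1"
  shows "(frac_kernel \<alpha> has_real_derivative - frac_kernel_density \<alpha> z) (at z)"
proof (cases "z < 1")
  case True
  have "((\<lambda>z. z powr (\<alpha> - 1)) has_real_derivative - frac_kernel_density \<alpha> z) (at z)"
    using has_real_derivative_powr[OF assms(1), of "\<alpha> - 1"] True
    by (simp add: frac_kernel_density_def algebra_simps)
  thus ?thesis
    by (rule has_field_derivative_transform_within_open[where S="{0<..<1}"])
       (use assms True in \<open>auto simp: frac_kernel_def max_def\<close>)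
next
  case False
  have "((\<lambda>z. (z - 1) powr \<alpha>) has_real_derivative \<alpha> * (z - 1) powr (\<alpha> - 1)) (at z)"
    using DERIV_shift[of "\<lambda>z. z powr \<alpha>" _ z "- 1"] has_real_derivative_powr[of "z - 1" \<alpha>] assms False
    by simp
  hence "((\<lambda>z. z powr (\<alpha> - 1) - (z - 1) powr \<alpha> / z) has_real_derivative
      (\<alpha> - 1) * z powr (\<alpha> - 1 - 1) - (\<alpha> * (z - 1) powr (\<alpha> - 1) * z - (z - 1) powr \<alpha> * 1) / (z * z)) (at z)"
    using assms by (intro DERIV_diff DERIV_divide DERIV_ident has_real_derivative_powr) auto
  moreover have "(\<alpha> - 1) * z powr (\<alpha> - 1 - 1) - (\<alpha> * (z - 1) powr (\<alpha> - 1) * z - (z - 1) powr \<alpha> * 1) / (z * z)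
      = - frac_kernel_density \<alpha> z"
    using assms False by (simp add: frac_kernel_density_def field_simps power2_eq_square)
  ultimately have "((\<lambda>z. z powr (\<alpha> - 1) - (z - 1) powr \<alpha> / z) has_real_derivative - frac_kernel_density \<alpha> z) (at z)"
    by simp
  thus ?thesis
    by (rule has_field_derivative_transform_within_open[where S="{1<..}"])
       (use assms False in \<open>auto simp: frac_kernel_def max_def\<close>)
qed

text \<open>Nonnegativity comes from (z - 1)_+^\<alpha> \<le> z^\<alpha> = z z^(\<alpha> - 1). The
  upper bound drops a nonnegative term; it yields the decay of k at infinity.\<close>

lemma frac_kernel_bounds:
  assumes "0 < \<alpha>" "0 < z"
  shows "0 \<le> frac_kernel \<alpha> z" "frac_kernel \<alpha> z \<le> z powr (\<alpha> - 1)"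
proof -
  have "max 0 (z - 1) powr \<alpha> \<le> z powr \<alpha>" using assms by (intro powr_mono2) auto
  moreover have "z powr \<alpha> = z * z powr (\<alpha> - 1)" using powr_mult_base[of z "\<alpha> - 1"] assms by simp
  ultimately show "0 \<le> frac_kernel \<alpha> z" using assms by (simp add: frac_kernel_def field_simps)
  show "frac_kernel \<alpha> z \<le> z powr (\<alpha> - 1)" using assms by (simp add: frac_kernel_def)
qed

text \<open>Fundamental theorem for -k, which is continuous across 1 but not differentiable there,
  whence the exceptional set \<open>{1}\<close>. The result presents k as a superposition of
  indicators of the intervals (0, r) with weight m(r).\<close>

lemma nn_integral_frac_kernel_density:
  assumes "0 < \<alpha>" "\<alpha> < 1" "0 < z"
  shows "(\<integral>\<^sup>+r\<in>{z<..}. ennreal (frac_kernel_density \<alpha> r) \<partial>lborel) = ennreal (frac_kernel \<alpha> z)"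
proof -
  have ev: "\<forall>\<^sub>F z in at_top. 0 \<le> frac_kernel \<alpha> z" "\<forall>\<^sub>F z in at_top. frac_kernel \<alpha> z \<le> z powr (\<alpha> - 1)"
    using eventually_gt_at_top[of "0::real"] by (eventually_elim, use frac_kernel_bounds assms in auto)+
  have "((\<lambda>z. z powr (\<alpha> - 1)) \<longlongrightarrow> 0) at_top"
    using assms by (intro tendsto_neg_powr filterlim_ident) auto
  from tendsto_sandwich[OF ev tendsto_const this] have lim: "(frac_kernel \<alpha> \<longlongrightarrow> 0) at_top" .
  have "(\<integral>\<^sup>+r\<in>{z<..}. ennreal (frac_kernel_density \<alpha> r) \<partial>lborel) = ennreal (- 0 - (- frac_kernel \<alpha> z))"
  proof (rule nn_integral_FTC_Ioi[where S="{1}"])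
    show "continuous_on {z..} (\<lambda>z. - frac_kernel \<alpha> z)"
      unfolding frac_kernel_def using assms by (intro continuous_intros continuous_on_powr') auto
    show "((\<lambda>z. - frac_kernel \<alpha> z) has_real_derivative frac_kernel_density \<alpha> x) (at x)" if "x \<in> {z<..} - {1}" for x
      using DERIV_minus[OF has_real_derivative_frac_kernel[of x \<alpha>]] that assms by auto
    show "((\<lambda>z. - frac_kernel \<alpha> z) \<longlongrightarrow> - 0) at_top" by (intro tendsto_intros lim)
  qed (use assms frac_kernel_density_nonneg in auto)
  thus ?thesis by simp
qed


section \<open>The normalising constant\<close>

text \<open>The substitution t = 1 / r carries the Beta integral B(1 - \<alpha>, \<alpha>) over (0,
  1) to the half-line r > 1.\<close>

lemma nn_integral_Beta_Ioi:
  assumes "0 < \<alpha>" "\<alpha> < 1"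
  shows "(\<integral>\<^sup>+r\<in>{1<..}. ennreal ((r - 1) powr (\<alpha> - 1) / r) \<partial>lborel) = ennreal (Gamma \<alpha> * Gamma (1 - \<alpha>))"
proof -
  define f where "f = (\<lambda>t::real. t powr ((1 - \<alpha>) - 1) * (1 - t) powr (\<alpha> - 1))"
  have img: "inverse ` {1<..} = {0<..<1::real}"
  proof (intro equalityI subsetI)
    fix t :: real assume "t \<in> {0<..<1}"
    thus "t \<in> inverse ` {1<..}"
      by (intro image_eqI[of _ _ "inverse t"]) (auto simp: one_less_inverse_iff)
  qed (auto simp: inverse_less_1_iff)
  have f: "(f has_integral Beta (1 - \<alpha>) \<alpha>) {0<..<1}"
    unfolding f_def using has_integral_Beta_real[of "1 - \<alpha>" \<alpha>] assms
    by (simp add: has_integral_Icc_iff_Ioo)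
  have "f absolutely_integrable_on {0<..<1}"
    using f by (intro nonnegative_absolutely_integrable_1) (auto simp: f_def integrable_on_def)
  \<comment> \<open>The change of variables theorem is an equivalence between pairs of absolute
    integrability and value, so both are carried along; the Jacobian of \<open>inverse\<close> is 1
    / r^2.\<close>
  hence "f absolutely_integrable_on inverse ` {1<..} \<and> integral (inverse ` {1<..}) f = Beta (1 - \<alpha>) \<alpha>"
    using f img by (simp add: integral_unique)
  also have "?this \<longleftrightarrow> (\<lambda>r. \<bar>- (inverse r ^ Suc (Suc 0))\<bar> * f (inverse r)) absolutely_integrable_on {1<..} \<and>
      integral {1<..} (\<lambda>r. \<bar>- (inverse r ^ Suc (Suc 0))\<bar> * f (inverse r)) = Beta (1 - \<alpha>) \<alpha>"
  proof (rule has_absolute_integral_change_of_variables_1'[symmetric])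
    show "(inverse has_real_derivative - (inverse r ^ Suc (Suc 0))) (at r within {1<..})" if "r \<in> {1<..}" for r :: real
      using that by (intro DERIV_inverse) auto
    show "inj_on inverse {1::real<..}" by (auto intro: inj_onI)
  qed auto
  finally have "((\<lambda>r. \<bar>- (inverse r ^ Suc (Suc 0))\<bar> * f (inverse r)) has_integral Beta (1 - \<alpha>) \<alpha>) {1<..}"
    using set_lebesgue_integral_eq_integral(1) by (auto simp: has_integral_iff)
  moreover have "\<bar>- (inverse r ^ Suc (Suc 0))\<bar> * f (inverse r) = (r - 1) powr (\<alpha> - 1) / r" if "r \<in> {1<..}" for r
  proof -
    from that have r: "r > 1" by simp
    have "f (inverse r) = r powr \<alpha> * ((r - 1) / r) powr (\<alpha> - 1)"
    proof -
      have "inverse r powr - \<alpha> = r powr \<alpha>" using r by (simp add: inverse_powr powr_minus)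
      moreover have "1 - inverse r = (r - 1) / r" using r by (simp add: field_simps)
      ultimately show ?thesis by (simp add: f_def)
    qed
    also have "\<dots> = r powr \<alpha> * (r - 1) powr (\<alpha> - 1) / r powr (\<alpha> - 1)"
      using r by (simp add: powr_divide)
    also have "\<dots> = r * (r - 1) powr (\<alpha> - 1)"
      using r by (simp add: powr_diff)
    finally show ?thesis using r by (simp add: field_simps)
  qed
  ultimately have *: "((\<lambda>r. (r - 1) powr (\<alpha> - 1) / r) has_integral Beta (1 - \<alpha>) \<alpha>) {1<..}"
    by (subst (asm) has_integral_cong) auto
  have "(\<integral>\<^sup>+r\<in>{1<..}. ennreal ((r - 1) powr (\<alpha> - 1) / r) \<partial>lborel)
      = (\<integral>\<^sup>+r. ennreal (indicator {1<..} r * ((r - 1) powr (\<alpha> - 1) / r)) \<partial>lborel)"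
    by (intro nn_integral_cong) (auto split: split_indicator)
  also have "\<dots> = Beta (1 - \<alpha>) \<alpha>"
    by (rule nn_integral_has_integral_lebesgue[OF _ *]) auto
  finally show ?thesis by (simp add: Beta_def mult.commute)
qed

text \<open>By \<open>mult_frac_kernel_density\<close>, r m(r) is the Beta density on r > 1 plus (1
  - \<alpha>) (r^(\<alpha> - 1) - (r - 1)_+^(\<alpha> - 1)). The last bracket contributes 1 /
  \<alpha> on (0, 1) and -1 / \<alpha> on r > 1, so it integrates to 0.\<close>

lemma nn_integral_mult_frac_kernel_density:
  assumes "0 < \<alpha>" "\<alpha> < 1"
  shows "(\<integral>\<^sup>+r\<in>{0<..}. ennreal (r * frac_kernel_density \<alpha> r) \<partial>lborel) = ennreal (Gamma \<alpha> * Gamma (1 - \<alpha>))"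
    (is "?X = ?B")
proof -
  have head: "(\<integral>\<^sup>+r\<in>{0<..<1}. ennreal (r powr (\<alpha> - 1)) \<partial>lborel) = ennreal (1 powr \<alpha> / \<alpha> - 0 powr \<alpha> / \<alpha>)"
  proof (rule nn_integral_FTC_Ioo[where S="{}" and F="\<lambda>r. r powr \<alpha> / \<alpha>"])
    show "continuous_on {0..1} (\<lambda>r. r powr \<alpha> / \<alpha>)"
      using assms by (intro continuous_intros continuous_on_powr') auto
    show "((\<lambda>r. r powr \<alpha> / \<alpha>) has_real_derivative r powr (\<alpha> - 1)) (at r)" if "r \<in> {0<..<1} - {}" for r
      using DERIV_cdivide[OF has_real_derivative_powr[of r \<alpha>], of \<alpha>] that assms by simp
  qed auto
  have tail: "(\<integral>\<^sup>+r\<in>{1<..}. ennreal ((r - 1) powr (\<alpha> - 1) - r powr (\<alpha> - 1)) \<partial>lborel)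
      = ennreal (0 - ((1 - 1) powr \<alpha> / \<alpha> - 1 powr \<alpha> / \<alpha>))"
  proof (rule nn_integral_FTC_Ioi[where S="{}" and F="\<lambda>r. (r - 1) powr \<alpha> / \<alpha> - r powr \<alpha> / \<alpha>"])
    show "continuous_on {1..} (\<lambda>r. (r - 1) powr \<alpha> / \<alpha> - r powr \<alpha> / \<alpha>)"
      using assms by (intro continuous_intros continuous_on_powr') auto
    show "((\<lambda>r. (r - 1) powr \<alpha> / \<alpha> - r powr \<alpha> / \<alpha>) has_real_derivative
        ((r - 1) powr (\<alpha> - 1) - r powr (\<alpha> - 1))) (at r)" if "r \<in> {1<..} - {}" for r
    proof -
      have "((\<lambda>r. (r - 1) powr \<alpha>) has_real_derivative \<alpha> * (r - 1) powr (\<alpha> - 1)) (at r)"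
        using DERIV_shift[of "\<lambda>z. z powr \<alpha>" _ r "- 1"] has_real_derivative_powr[of "r - 1" \<alpha>] that by simp
      from DERIV_diff[OF DERIV_cdivide[OF this, of \<alpha>] DERIV_cdivide[OF has_real_derivative_powr[of r \<alpha>], of \<alpha>]]
      show ?thesis using that assms by simp
    qed
    show "((\<lambda>r. (r - 1) powr \<alpha> / \<alpha> - r powr \<alpha> / \<alpha>) \<longlongrightarrow> 0) at_top"
    proof -
      \<comment> \<open>The two powers in the antiderivative both diverge, but (r - 1)^\<alpha>
        \<ge> (r - 1) r^(\<alpha> - 1) = r^\<alpha> - r^(\<alpha> - 1), so their difference is
        squeezed to 0.\<close>
      have *: "r powr \<alpha> - (r - 1) powr \<alpha> \<le> r powr (\<alpha> - 1)" if "r > 1" for r :: real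
      proof -
        have "r powr (\<alpha> - 1) * (r - 1) \<le> (r - 1) powr (\<alpha> - 1) * (r - 1)"
          using that assms by (intro mult_right_mono powr_mono2') auto
        moreover have "(r - 1) powr (\<alpha> - 1) * (r - 1) = (r - 1) powr \<alpha>"
          using powr_mult_base[of "r - 1" "\<alpha> - 1"] that by (simp add: mult.commute)
        moreover have "r powr (\<alpha> - 1) * r = r powr \<alpha>"
          using powr_mult_base[of r "\<alpha> - 1"] that by (simp add: mult.commute)
        ultimately show ?thesis by (simp add: algebra_simps)
      qed
      have 1: "\<forall>\<^sub>F r in at_top. - (r powr (\<alpha> - 1) / \<alpha>) \<le> (r - 1) powr \<alpha> / \<alpha> - r powr \<alpha> / \<alpha>"
        using eventually_gt_at_top[of "1::real"]
      proof eventually_elim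
        case (elim r)
        from divide_right_mono[OF *[OF this], of \<alpha>] assms show ?case by (simp add: diff_divide_distrib)
      qed
      have 2: "\<forall>\<^sub>F r in at_top. (r - 1) powr \<alpha> / \<alpha> - r powr \<alpha> / \<alpha> \<le> 0"
        using eventually_gt_at_top[of "1::real"]
        by eventually_elim (use assms in \<open>auto intro!: divide_right_mono powr_mono2\<close>)
      have "((\<lambda>r. r powr (\<alpha> - 1)) \<longlongrightarrow> 0) at_top"
        using assms by (intro tendsto_neg_powr filterlim_ident) auto
      from tendsto_minus[OF tendsto_divide[OF this tendsto_const[of \<alpha>]]]
      have 3: "((\<lambda>r. - (r powr (\<alpha> - 1) / \<alpha>)) \<longlongrightarrow> 0) at_top" using assms by simp
      from tendsto_sandwich[OF 1 2 3 tendsto_const] show ?thesis .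
    qed
  qed (use assms in \<open>auto intro!: powr_mono2'\<close>)
  let ?c = "ennreal (1 - \<alpha>)"
  \<comment> \<open>To avoid subtraction in [0, \<infinity>], the negative contribution on r > 1 is
    added to the left side.\<close>
  have "?X + ?c * (\<integral>\<^sup>+r\<in>{1<..}. ennreal ((r - 1) powr (\<alpha> - 1) - r powr (\<alpha> - 1)) \<partial>lborel) =
      (\<integral>\<^sup>+r. ennreal (r * frac_kernel_density \<alpha> r) * indicator {0<..} r +
         ?c * (ennreal ((r - 1) powr (\<alpha> - 1) - r powr (\<alpha> - 1)) * indicator {1<..} r) \<partial>lborel)"
    by (simp add: nn_integral_add nn_integral_cmult)
  also have "\<dots> = (\<integral>\<^sup>+r. ennreal ((r - 1) powr (\<alpha> - 1) / r) * indicator {1<..} r +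
         ?c * (ennreal (r powr (\<alpha> - 1)) * indicator {0<..<1} r) \<partial>lborel)"
  proof (rule nn_integral_cong_AE)
    \<comment> \<open>The point 1 lies in \<open>{0<..}\<close> but in neither
      \<open>{0<..<1}\<close> nor \<open>{1<..}\<close>, so the integrands differ there.\<close>
    have "AE r in lborel. r \<noteq> (1::real)" by (rule AE_lborel_singleton)
    thus "AE r in lborel. ennreal (r * frac_kernel_density \<alpha> r) * indicator {0<..} r +
         ?c * (ennreal ((r - 1) powr (\<alpha> - 1) - r powr (\<alpha> - 1)) * indicator {1<..} r) =
         ennreal ((r - 1) powr (\<alpha> - 1) / r) * indicator {1<..} r +
         ?c * (ennreal (r powr (\<alpha> - 1)) * indicator {0<..<1} r)"
    proof eventually_elim
      case (elim r)
      consider "r \<le> 0" | "0 < r" "r < 1" | "1 < r" using elim by linarith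
      thus ?case
      proof cases
        case 2
        thus ?thesis using assms by (simp add: mult_frac_kernel_density ennreal_mult')
      next
        case 3
        have "0 \<le> r * frac_kernel_density \<alpha> r" using frac_kernel_density_nonneg[of \<alpha> r] assms 3 by simp
        moreover have "r powr (\<alpha> - 1) \<le> (r - 1) powr (\<alpha> - 1)" using assms 3 by (intro powr_mono2') auto
        moreover have "r * frac_kernel_density \<alpha> r + (1 - \<alpha>) * ((r - 1) powr (\<alpha> - 1) - r powr (\<alpha> - 1))
            = (r - 1) powr (\<alpha> - 1) / r"
          using 3 by (simp add: mult_frac_kernel_density algebra_simps)
        ultimately show ?thesis
          using 3 assms by (simp flip: ennreal_mult' ennreal_plus)
      qed auto
    qed
  qed
  also have "\<dots> = ?B + ?c * (\<integral>\<^sup>+r\<in>{0<..<1}. ennreal (r powr (\<alpha> - 1)) \<partial>lborel)"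
    by (simp add: nn_integral_add nn_integral_cmult nn_integral_Beta_Ioi[OF assms])
  \<comment> \<open>\<open>head\<close> and \<open>tail\<close> both have the value 1 / \<alpha>;
    the same finite term therefore stands on both sides and can be cancelled.\<close>
  finally have "?c * ennreal (1 / \<alpha>) + ?X = ?c * ennreal (1 / \<alpha>) + ?B"
    using assms unfolding head tail by (simp add: add.commute)
  thus ?thesis
    by (subst (asm) ennreal_add_left_cancel) (auto simp: ennreal_mult_eq_top_iff)
qed

section \<open>The two interchanges of integration\<close>

text \<open>This mass of the singular kernel beyond distance \<epsilon> is the coefficient of u(x)
  in the truncated derivative.\<close>

lemma nn_integral_powr_Ioi:
  assumes "0 < \<alpha>" "0 < \<epsilon>"
  shows "(\<integral>\<^sup>+t\<in>{x + \<epsilon><..}. ennreal (1 / (t - x) powr (1 + \<alpha>)) \<partial>lborel) = ennreal (\<epsilon> powr - \<alpha> / \<alpha>)"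
proof -
  have "(\<integral>\<^sup>+t\<in>{x + \<epsilon><..}. ennreal (1 / (t - x) powr (1 + \<alpha>)) \<partial>lborel)
      = ennreal (0 - (- ((x + \<epsilon> - x) powr - \<alpha> / \<alpha>)))"
  proof (rule nn_integral_FTC_Ioi[where S="{}" and F="\<lambda>t. - ((t - x) powr - \<alpha> / \<alpha>)"])
    show "continuous_on {x + \<epsilon>..} (\<lambda>t. - ((t - x) powr - \<alpha> / \<alpha>))"
      using assms by (intro continuous_intros) auto
    show "((\<lambda>t. - ((t - x) powr - \<alpha> / \<alpha>)) has_real_derivative 1 / (t - x) powr (1 + \<alpha>)) (at t)"
      if "t \<in> {x + \<epsilon><..} - {}" for t
    proof -
      have pos: "0 < t - x" using that assms by simp
      have "((\<lambda>t. (t - x) powr - \<alpha>) has_real_derivative - \<alpha> * (t - x) powr (- \<alpha> - 1)) (at t)"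
        using DERIV_shift[of "\<lambda>z. z powr - \<alpha>" _ t "- x"] has_real_derivative_powr[OF pos, of "- \<alpha>"] by simp
      from DERIV_minus[OF DERIV_cdivide[OF this, of \<alpha>]]
      have "((\<lambda>t. - ((t - x) powr - \<alpha> / \<alpha>)) has_real_derivative (t - x) powr (- \<alpha> - 1)) (at t)"
        using assms by simp
      moreover have "(t - x) powr (- \<alpha> - 1) = 1 / (t - x) powr (1 + \<alpha>)"
      proof -
        have "- \<alpha> - 1 = - (1 + \<alpha>)" by simp
        thus ?thesis by (simp only: powr_minus_divide)
      qed
      ultimately show ?thesis by simp
    qed
    have "filterlim (\<lambda>t. - x + t) at_top at_top"
      by (intro filterlim_tendsto_add_at_top[OF tendsto_const] filterlim_ident)
    hence "((\<lambda>t. (t - x) powr - \<alpha>) \<longlongrightarrow> 0) at_top"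
      using assms by (intro tendsto_neg_powr) (auto simp: algebra_simps)
    from tendsto_minus[OF tendsto_divide[OF this tendsto_const[of \<alpha>]]]
    show "((\<lambda>t. - ((t - x) powr - \<alpha> / \<alpha>)) \<longlongrightarrow> 0) at_top" using assms by simp
  qed auto
  thus ?thesis by simp
qed

text \<open>The substitution \<open>z = (s - t) / (t - x)\<close> makes the integrand a multiple of \<open>z\<^sup>\<alpha>\<^sup>-\<^sup>1\<close>.\<close>
lemma nn_integral_powr_Beta_incomplete:
  assumes "0 < \<alpha>" "\<alpha> < 1" "0 < \<epsilon>" "x + \<epsilon> \<le> s"
  shows "(\<integral>\<^sup>+t\<in>{x + \<epsilon><..<s}. ennreal (1 / ((s - t) powr (1 - \<alpha>) * (t - x) powr (1 + \<alpha>))) \<partial>lborel)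
    = ennreal (((s - (x + \<epsilon>)) / \<epsilon>) powr \<alpha> / (\<alpha> * (s - x)))"
proof -
  let ?F = "\<lambda>t. - (((s - t) / (t - x)) powr \<alpha> / (\<alpha> * (s - x)))"
  have "(\<integral>\<^sup>+t\<in>{x + \<epsilon><..<s}. ennreal (1 / ((s - t) powr (1 - \<alpha>) * (t - x) powr (1 + \<alpha>))) \<partial>lborel)
    = ennreal (?F s - ?F (x + \<epsilon>))"
  proof (rule nn_integral_FTC_Ioo[where S="{}" and F="?F"])
    show "continuous_on {x + \<epsilon>..s} ?F"
      using assms by (intro continuous_intros continuous_on_powr') auto
    show "(?F has_real_derivative 1 / ((s - t) powr (1 - \<alpha>) * (t - x) powr (1 + \<alpha>))) (at t)"
      if "t \<in> {x + \<epsilon><..<s} - {}" for t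
    proof -
      have pos: "0 < s - t" "0 < t - x" "0 < s - x" using that assms by auto
      have "((\<lambda>t. (s - t) / (t - x)) has_real_derivative - ((s - x) / (t - x)\<^sup>2)) (at t)"
      proof (rule DERIV_cong)
        show "((\<lambda>t. (s - t) / (t - x)) has_real_derivative
            ((0 - 1) * (t - x) - (s - t) * (1 - 0)) / ((t - x) * (t - x))) (at t)"
          using pos by (intro DERIV_divide DERIV_diff DERIV_const DERIV_ident) auto
        have "(0 - 1) * (t - x) - (s - t) * (1 - 0) = - (s - x)" by simp
        thus "((0 - 1) * (t - x) - (s - t) * (1 - 0)) / ((t - x) * (t - x)) = - ((s - x) / (t - x)\<^sup>2)"
          by (simp only: power2_eq_square minus_divide_left)
      qed
      from DERIV_chain2[OF has_real_derivative_powr this, of \<alpha>] pos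
      have "((\<lambda>t. ((s - t) / (t - x)) powr \<alpha>) has_real_derivative
          \<alpha> * ((s - t) / (t - x)) powr (\<alpha> - 1) * - ((s - x) / (t - x)\<^sup>2)) (at t)" by simp
      from DERIV_minus[OF DERIV_cdivide[OF this, of "\<alpha> * (s - x)"]]
      have "(?F has_real_derivative ((s - t) / (t - x)) powr (\<alpha> - 1) / (t - x)\<^sup>2) (at t)"
        using assms pos by simp
      moreover have "((s - t) / (t - x)) powr (\<alpha> - 1) / (t - x)\<^sup>2 =
          1 / ((s - t) powr (1 - \<alpha>) * (t - x) powr (1 + \<alpha>))"
      proof -
        have "(t - x) powr (1 + \<alpha>) = (t - x)\<^sup>2 * (t - x) powr (\<alpha> - 1)"
          using pos powr_add[of "t - x" 2 "\<alpha> - 1"] by (simp add: powr_numeral add.commute)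
        moreover have "(s - t) powr (\<alpha> - 1) = 1 / (s - t) powr (1 - \<alpha>)"
          using powr_minus_divide[of "s - t" "1 - \<alpha>"] by simp
        ultimately show ?thesis using pos by (simp add: powr_divide field_simps)
      qed
      ultimately show ?thesis by simp
    qed
  qed (use assms in auto)
  \<comment> \<open>The antiderivative vanishes at \<open>t = s\<close>, where its base is
    0.\<close>
  thus ?thesis using assms by simp
qed

text \<open>\<open>\<Gamma>(\<alpha>) W\<^sub>\<alpha> g\<close>, without the normalising factor.\<close>
definition frac_potential :: "real \<Rightarrow> (real \<Rightarrow> real) \<Rightarrow> real \<Rightarrow> ennreal" where
  "frac_potential \<alpha> g x = (\<integral>\<^sup>+s\<in>{x<..}. ennreal (g s / (s - x) powr (1 - \<alpha>)) \<partial>lborel)"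

text \<open>With the condition \<open>x < s\<close> inside the integrand, joint measurability in x
  and s becomes visible.\<close>

lemma frac_potential_eq:
  "frac_potential \<alpha> g x = (\<integral>\<^sup>+s. ennreal (if x < s then g s / (s - x) powr (1 - \<alpha>) else 0) \<partial>lborel)"
  unfolding frac_potential_def by (intro nn_integral_cong) auto

lemma measurable_frac_potential [measurable]:
  assumes [measurable]: "g \<in> borel_measurable borel"
  shows "frac_potential \<alpha> g \<in> borel_measurable borel"
  unfolding frac_potential_eq by measurable

text \<open>For g \<ge> 0 and u = W_\<alpha> g this is \<Gamma>(\<alpha>) \<Gamma>(1 - \<alpha>)
  times the truncated derivative at points of finite potential: g averaged over s > x against the
  dilated kernel k.\<close>

definition frac_approx :: "real \<Rightarrow> (real \<Rightarrow> real) \<Rightarrow> real \<Rightarrow> real \<Rightarrow> ennreal" where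
  "frac_approx \<alpha> g x \<epsilon> = (\<integral>\<^sup>+s\<in>{x<..}. ennreal (g s * (frac_kernel \<alpha> ((s - x) / \<epsilon>) / \<epsilon>)) \<partial>lborel)"

text \<open>Tonelli on the region x + \<epsilon> < t < s, with the inner integral over t given by
  \<open>nn_integral_powr_Beta_incomplete\<close>. The \<open>max 0\<close> covers s \<le> x +
  \<epsilon>, where no such t exists.\<close>

lemma nn_integral_frac_potential:
  assumes \<alpha>: "0 < \<alpha>" "\<alpha> < 1" and \<epsilon>: "0 < \<epsilon>"
    and g [measurable]: "g \<in> borel_measurable borel" and nonneg: "\<And>s. 0 \<le> g s"
  shows "(\<integral>\<^sup>+t\<in>{x + \<epsilon><..}. frac_potential \<alpha> g t * ennreal (1 / (t - x) powr (1 + \<alpha>)) \<partial>lborel)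
      = (\<integral>\<^sup>+s\<in>{x<..}. ennreal (g s * (max 0 ((s - x) / \<epsilon> - 1) powr \<alpha> / (\<alpha> * (s - x)))) \<partial>lborel)"
proof -
  define H where "H = (\<lambda>s t. ennreal (if x + \<epsilon> < t \<and> t < s then g s / ((s - t) powr (1 - \<alpha>) * (t - x) powr (1 + \<alpha>)) else 0))"
  have [measurable]: "case_prod H \<in> borel_measurable (lborel \<Otimes>\<^sub>M lborel)"
    unfolding H_def by measurable
  have "(\<integral>\<^sup>+t\<in>{x + \<epsilon><..}. frac_potential \<alpha> g t * ennreal (1 / (t - x) powr (1 + \<alpha>)) \<partial>lborel)
      = (\<integral>\<^sup>+t. (\<integral>\<^sup>+s. H s t \<partial>lborel) \<partial>lborel)"
  proof (intro nn_integral_cong)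
    fix t
    show "frac_potential \<alpha> g t * ennreal (1 / (t - x) powr (1 + \<alpha>)) * indicator {x + \<epsilon><..} t = (\<integral>\<^sup>+s. H s t \<partial>lborel)"
    proof (cases "x + \<epsilon> < t")
      case True
      have "frac_potential \<alpha> g t * ennreal (1 / (t - x) powr (1 + \<alpha>)) =
          (\<integral>\<^sup>+s. ennreal (if t < s then g s / (s - t) powr (1 - \<alpha>) else 0) * ennreal (1 / (t - x) powr (1 + \<alpha>)) \<partial>lborel)"
        unfolding frac_potential_eq by (rule nn_integral_multc[symmetric]) measurable
      also have "\<dots> = (\<integral>\<^sup>+s. H s t \<partial>lborel)"
        by (intro nn_integral_cong) (use True in \<open>auto simp: H_def nonneg simp flip: ennreal_mult\<close>)
      finally show ?thesis using True by simp
    qed (simp add: H_def)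
  qed
  also have "\<dots> = (\<integral>\<^sup>+s. (\<integral>\<^sup>+t. H s t \<partial>lborel) \<partial>lborel)"
    by (rule lborel_pair.Fubini') measurable
  also have "\<dots> = (\<integral>\<^sup>+s\<in>{x<..}. ennreal (g s * (max 0 ((s - x) / \<epsilon> - 1) powr \<alpha> / (\<alpha> * (s - x)))) \<partial>lborel)"
  proof (intro nn_integral_cong)
    fix s
    show "(\<integral>\<^sup>+t. H s t \<partial>lborel) = ennreal (g s * (max 0 ((s - x) / \<epsilon> - 1) powr \<alpha> / (\<alpha> * (s - x)))) * indicator {x<..} s"
    proof (cases "x + \<epsilon> < s")
      case True
      have "(\<integral>\<^sup>+t. H s t \<partial>lborel) = (\<integral>\<^sup>+t. ennreal (g s) *
          (ennreal (1 / ((s - t) powr (1 - \<alpha>) * (t - x) powr (1 + \<alpha>))) * indicator {x + \<epsilon><..<s} t) \<partial>lborel)"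
        by (intro nn_integral_cong) (auto simp: H_def nonneg simp flip: ennreal_mult)
      also have "\<dots> = ennreal (g s) * ennreal (((s - (x + \<epsilon>)) / \<epsilon>) powr \<alpha> / (\<alpha> * (s - x)))"
        using True nn_integral_powr_Beta_incomplete[OF \<alpha> \<epsilon>, of x s] by (subst nn_integral_cmult) auto
      also have "\<dots> = ennreal (g s * (((s - (x + \<epsilon>)) / \<epsilon>) powr \<alpha> / (\<alpha> * (s - x))))"
        by (rule ennreal_mult'[OF nonneg, symmetric])
      also have "(s - (x + \<epsilon>)) / \<epsilon> = max 0 ((s - x) / \<epsilon> - 1)"
        using True \<epsilon> by (simp add: max_def field_simps)
      finally show ?thesis using True \<epsilon> by simp
    next
      case False
      hence "H s = (\<lambda>t. 0)" by (auto simp: H_def fun_eq_iff)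
      moreover from False \<epsilon> have "max 0 ((s - x) / \<epsilon> - 1) = 0" by (simp add: max_def field_simps)
      ultimately show ?thesis by simp
    qed
  qed
  finally show ?thesis .
qed

text \<open>This is the formula for the truncated derivative, written as a sum so that it holds in
  [0, \<infinity>]. With z = (s - x) / \<epsilon> the integrands agree for each s, because k(z) + (z
  - 1)_+^\<alpha> / z = z^(\<alpha> - 1).\<close>

lemma nn_integral_frac_potential_plus_approx:
  assumes \<alpha>: "0 < \<alpha>" "\<alpha> < 1" and \<epsilon>: "0 < \<epsilon>"
    and g [measurable]: "g \<in> borel_measurable borel" and nonneg: "\<And>s. 0 \<le> g s"
  shows "(\<integral>\<^sup>+t\<in>{x + \<epsilon><..}. frac_potential \<alpha> g t * ennreal (1 / (t - x) powr (1 + \<alpha>)) \<partial>lborel)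
      + ennreal (1 / \<alpha>) * frac_approx \<alpha> g x \<epsilon> = ennreal (\<epsilon> powr - \<alpha> / \<alpha>) * frac_potential \<alpha> g x"
proof -
  have "(\<integral>\<^sup>+t\<in>{x + \<epsilon><..}. frac_potential \<alpha> g t * ennreal (1 / (t - x) powr (1 + \<alpha>)) \<partial>lborel)
      + ennreal (1 / \<alpha>) * frac_approx \<alpha> g x \<epsilon> =
      (\<integral>\<^sup>+s. ennreal (g s * (max 0 ((s - x) / \<epsilon> - 1) powr \<alpha> / (\<alpha> * (s - x)))) * indicator {x<..} s +
         ennreal (1 / \<alpha>) * (ennreal (g s * (frac_kernel \<alpha> ((s - x) / \<epsilon>) / \<epsilon>)) * indicator {x<..} s) \<partial>lborel)"
    unfolding nn_integral_frac_potential[OF assms] frac_approx_def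
    by (simp add: nn_integral_add nn_integral_cmult)
  also have "\<dots> = (\<integral>\<^sup>+s. ennreal (\<epsilon> powr - \<alpha> / \<alpha>) * (ennreal (g s / (s - x) powr (1 - \<alpha>)) * indicator {x<..} s) \<partial>lborel)"
  proof (intro nn_integral_cong)
    fix s
    show "ennreal (g s * (max 0 ((s - x) / \<epsilon> - 1) powr \<alpha> / (\<alpha> * (s - x)))) * indicator {x<..} s +
         ennreal (1 / \<alpha>) * (ennreal (g s * (frac_kernel \<alpha> ((s - x) / \<epsilon>) / \<epsilon>)) * indicator {x<..} s)
         = ennreal (\<epsilon> powr - \<alpha> / \<alpha>) * (ennreal (g s / (s - x) powr (1 - \<alpha>)) * indicator {x<..} s)"
    proof (cases "x < s")
      case True
      define z where "z = (s - x) / \<epsilon>"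
      have z: "0 < z" "s - x = \<epsilon> * z" using True \<epsilon> by (auto simp: z_def)
      have kz: "z powr (\<alpha> - 1) / \<epsilon> = \<epsilon> powr - \<alpha> / (s - x) powr (1 - \<alpha>)"
      proof -
        have "(s - x) powr (1 - \<alpha>) = \<epsilon> powr (1 - \<alpha>) * z powr (1 - \<alpha>)"
          unfolding z using z \<epsilon> by (simp add: powr_mult)
        moreover have "z powr (\<alpha> - 1) = 1 / z powr (1 - \<alpha>)"
          using powr_minus_divide[of z "1 - \<alpha>"] by simp
        moreover have "\<epsilon> powr (1 - \<alpha>) = \<epsilon> * \<epsilon> powr - \<alpha>"
          using powr_mult_base[of \<epsilon> "- \<alpha>"] \<epsilon> by simp
        ultimately show ?thesis using z \<epsilon> by (simp add: field_simps)
      qed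
      \<comment> \<open>Here \<open>Z\<close> stands for z^(\<alpha> - 1) and \<open>M\<close> for
        (z - 1)_+^\<alpha>; the terms in \<open>M\<close> cancel.\<close>
      have gen: "g s * (M / (\<alpha> * (\<epsilon> * z))) + 1 / \<alpha> * (g s * ((Z - M / z) / \<epsilon>)) = g s / \<alpha> * (Z / \<epsilon>)"
        for M Z using z(1) \<epsilon> \<alpha> by (simp add: field_simps)
      have "g s * (max 0 (z - 1) powr \<alpha> / (\<alpha> * (s - x))) + 1 / \<alpha> * (g s * (frac_kernel \<alpha> z / \<epsilon>)) =
          g s / \<alpha> * (z powr (\<alpha> - 1) / \<epsilon>)"
        unfolding frac_kernel_def z(2) by (rule gen)
      also have "\<dots> = \<epsilon> powr - \<alpha> / \<alpha> * (g s / (s - x) powr (1 - \<alpha>))"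
        unfolding kz by simp
      finally have E: "g s * (max 0 (z - 1) powr \<alpha> / (\<alpha> * (s - x))) + 1 / \<alpha> * (g s * (frac_kernel \<alpha> z / \<epsilon>)) =
          \<epsilon> powr - \<alpha> / \<alpha> * (g s / (s - x) powr (1 - \<alpha>))" .
      have 1: "0 \<le> g s * (max 0 (z - 1) powr \<alpha> / (\<alpha> * (s - x)))" "0 \<le> g s * (frac_kernel \<alpha> z / \<epsilon>)"
        using True \<alpha> \<epsilon> z frac_kernel_bounds(1)[of \<alpha> z] nonneg by simp_all
      have combine: "ennreal A + ennreal c * ennreal B = ennreal d * ennreal D"
        if "A + c * B = d * D" "0 \<le> A" "0 \<le> B" "0 \<le> c" "0 \<le> d" for A B c d D :: real
        using that by (simp flip: ennreal_mult' ennreal_plus)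
      have "ennreal (g s * (max 0 (z - 1) powr \<alpha> / (\<alpha> * (s - x)))) +
          ennreal (1 / \<alpha>) * ennreal (g s * (frac_kernel \<alpha> z / \<epsilon>)) =
          ennreal (\<epsilon> powr - \<alpha> / \<alpha>) * ennreal (g s / (s - x) powr (1 - \<alpha>))"
        using \<alpha> by (intro combine[OF E 1]) auto
      thus ?thesis using True by (simp only: z_def[symmetric] indicator_simps greaterThan_iff mult_1_right)
    qed simp
  qed
  also have "\<dots> = ennreal (\<epsilon> powr - \<alpha> / \<alpha>) * frac_potential \<alpha> g x"
    unfolding frac_potential_def by (rule nn_integral_cmult) measurable
  finally show ?thesis .
qed

text \<open>Layer-cake argument: k((s - x) / \<epsilon>) is the integral of m over r > (s - x) /
  \<epsilon>, and this condition on r says s < x + \<epsilon> r. Tonelli then leaves integrals of g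
  over intervals starting at x.\<close>

lemma frac_approx_eq_averages:
  assumes \<alpha>: "0 < \<alpha>" "\<alpha> < 1" and \<epsilon>: "0 < \<epsilon>"
    and g [measurable]: "g \<in> borel_measurable borel" and nonneg: "\<And>s. 0 \<le> g s"
  shows "frac_approx \<alpha> g x \<epsilon> =
    (\<integral>\<^sup>+r\<in>{0<..}. ennreal (frac_kernel_density \<alpha> r / \<epsilon>) * (\<integral>\<^sup>+s\<in>{x<..<x + \<epsilon> * r}. ennreal (g s) \<partial>lborel) \<partial>lborel)"
proof -
  define H where "H = (\<lambda>r s. ennreal (if x < s \<and> s < x + \<epsilon> * r then frac_kernel_density \<alpha> r / \<epsilon> * g s else 0))"
  have [measurable]: "case_prod H \<in> borel_measurable (lborel \<Otimes>\<^sub>M lborel)"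
    unfolding H_def by measurable
  have "frac_approx \<alpha> g x \<epsilon> = (\<integral>\<^sup>+s. (\<integral>\<^sup>+r. H r s \<partial>lborel) \<partial>lborel)"
    unfolding frac_approx_def
  proof (intro nn_integral_cong)
    fix s
    show "ennreal (g s * (frac_kernel \<alpha> ((s - x) / \<epsilon>) / \<epsilon>)) * indicator {x<..} s = (\<integral>\<^sup>+r. H r s \<partial>lborel)"
    proof (cases "x < s")
      case True
      define z where "z = (s - x) / \<epsilon>"
      have z: "0 < z" "s - x = \<epsilon> * z" using True \<epsilon> by (auto simp: z_def)
      have "(\<integral>\<^sup>+r. H r s \<partial>lborel) =
          (\<integral>\<^sup>+r. ennreal (g s / \<epsilon>) * (ennreal (frac_kernel_density \<alpha> r) * indicator {z<..} r) \<partial>lborel)"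
      proof (intro nn_integral_cong)
        fix r
        have "s < x + \<epsilon> * r \<longleftrightarrow> z < r" using \<epsilon> by (simp add: z_def field_simps)
        thus "H r s = ennreal (g s / \<epsilon>) * (ennreal (frac_kernel_density \<alpha> r) * indicator {z<..} r)"
          using True \<epsilon> nonneg frac_kernel_density_nonneg[OF \<alpha>, of r] z
          by (simp add: H_def mult.commute flip: ennreal_mult')
      qed
      also have "\<dots> = ennreal (g s / \<epsilon>) * ennreal (frac_kernel \<alpha> z)"
        using nn_integral_frac_kernel_density[OF \<alpha> z(1)] by (subst nn_integral_cmult) auto
      also have "\<dots> = ennreal (g s * (frac_kernel \<alpha> z / \<epsilon>))"
        using nonneg \<epsilon> by (simp flip: ennreal_mult')
      finally show ?thesis using True by (simp add: z_def)
    qed (simp add: H_def)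
  qed
  also have "\<dots> = (\<integral>\<^sup>+r. (\<integral>\<^sup>+s. H r s \<partial>lborel) \<partial>lborel)"
    by (rule lborel_pair.Fubini') measurable
  also have "\<dots> = (\<integral>\<^sup>+r\<in>{0<..}. ennreal (frac_kernel_density \<alpha> r / \<epsilon>) * (\<integral>\<^sup>+s\<in>{x<..<x + \<epsilon> * r}. ennreal (g s) \<partial>lborel) \<partial>lborel)"
  proof (intro nn_integral_cong)
    fix r
    show "(\<integral>\<^sup>+s. H r s \<partial>lborel) =
      ennreal (frac_kernel_density \<alpha> r / \<epsilon>) * (\<integral>\<^sup>+s\<in>{x<..<x + \<epsilon> * r}. ennreal (g s) \<partial>lborel) * indicator {0<..} r"
    proof (cases "0 < r")
      case True
      have "(\<integral>\<^sup>+s. H r s \<partial>lborel) =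
          (\<integral>\<^sup>+s. ennreal (frac_kernel_density \<alpha> r / \<epsilon>) * (ennreal (g s) * indicator {x<..<x + \<epsilon> * r} s) \<partial>lborel)"
        by (intro nn_integral_cong)
           (use True frac_kernel_density_nonneg[OF \<alpha>, of r] \<epsilon> nonneg in \<open>auto simp: H_def simp flip: ennreal_mult'\<close>)
      also have "\<dots> = ennreal (frac_kernel_density \<alpha> r / \<epsilon>) * (\<integral>\<^sup>+s\<in>{x<..<x + \<epsilon> * r}. ennreal (g s) \<partial>lborel)"
        by (rule nn_integral_cmult) measurable
      finally show ?thesis using True by simp
    next
      case False
      hence "\<epsilon> * r \<le> 0" using \<epsilon> by (simp add: mult_le_0_iff)
      hence "H r = (\<lambda>s. 0)" by (auto simp: H_def fun_eq_iff)
      thus ?thesis using False by simp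
    qed
  qed
  finally show ?thesis .
qed


section \<open>One-sided averages and the limit of the approximations\<close>

text \<open>An infinite integral would be read as 0 by \<open>enn2real\<close>; the limit arguments
  establish finiteness of these integrals first.\<close>

definition right_average :: "(real \<Rightarrow> real) \<Rightarrow> real \<Rightarrow> real \<Rightarrow> real" where
  "right_average g x h = enn2real (\<integral>\<^sup>+s\<in>{x<..<x + h}. ennreal (g s) \<partial>lborel) / h"

lemma measurable_right_average [measurable]:
  assumes [measurable]: "g \<in> borel_measurable borel"
  shows "right_average g x \<in> borel_measurable borel"
proof -
  have "right_average g x = (\<lambda>h. enn2real (\<integral>\<^sup>+s. ennreal (if x < s \<and> s < x + h then g s else 0) \<partial>lborel) / h)"
    unfolding right_average_def
    by (intro ext arg_cong2[where f="(/)"] arg_cong[where f=enn2real] nn_integral_cong) auto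
  also have "\<dots> \<in> borel_measurable borel" by measurable
  finally show ?thesis .
qed

lemma right_average_nonneg: "0 < h \<Longrightarrow> 0 \<le> right_average g x h"
  by (simp add: right_average_def)

text \<open>On the interval (s - x)^(1 - \<alpha>) \<le> h^(1 - \<alpha>), so g is at most h^(1 -
  \<alpha>) times the integrand of the potential.\<close>

lemma nn_integral_le_frac_potential:
  assumes "\<alpha> < 1" and g [measurable]: "g \<in> borel_measurable borel" and nonneg: "\<And>s. 0 \<le> g s"
  shows "(\<integral>\<^sup>+s\<in>{x<..<x + h}. ennreal (g s) \<partial>lborel) \<le> ennreal (h powr (1 - \<alpha>)) * frac_potential \<alpha> g x"
proof -
  have "(\<integral>\<^sup>+s\<in>{x<..<x + h}. ennreal (g s) \<partial>lborel) \<le>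
      (\<integral>\<^sup>+s. ennreal (h powr (1 - \<alpha>)) * (ennreal (g s / (s - x) powr (1 - \<alpha>)) * indicator {x<..} s) \<partial>lborel)"
  proof (intro nn_integral_mono)
    fix s
    show "ennreal (g s) * indicator {x<..<x + h} s \<le>
      ennreal (h powr (1 - \<alpha>)) * (ennreal (g s / (s - x) powr (1 - \<alpha>)) * indicator {x<..} s)"
    proof (cases "s \<in> {x<..<x + h}")
      case True
      have "(s - x) powr (1 - \<alpha>) \<le> h powr (1 - \<alpha>)"
        using True assms by (intro powr_mono2) auto
      hence "g s * (s - x) powr (1 - \<alpha>) \<le> g s * h powr (1 - \<alpha>)"
        by (rule mult_left_mono) (rule nonneg)
      hence "g s \<le> h powr (1 - \<alpha>) * (g s / (s - x) powr (1 - \<alpha>))"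
        using True by (simp add: field_simps)
      thus ?thesis using True by (simp add: ennreal_leI flip: ennreal_mult')
    qed simp
  qed
  also have "\<dots> = ennreal (h powr (1 - \<alpha>)) * frac_potential \<alpha> g x"
    unfolding frac_potential_def by (rule nn_integral_cmult) measurable
  finally show ?thesis .
qed

text \<open>Averages over short intervals are controlled by convergence to \<open>L\<close>, those
  over long ones by h^(-\<alpha>) times the potential at x, which decreases in h. The bound is the
  constant in the dominating function of the limit argument.\<close>

lemma right_average_bounded:
  assumes \<alpha>: "0 < \<alpha>" "\<alpha> < 1"
    and g [measurable]: "g \<in> borel_measurable borel" and nonneg: "\<And>s. 0 \<le> g s"
    and fin: "frac_potential \<alpha> g x < \<infinity>"
    and lim: "(right_average g x \<longlongrightarrow> L) (at_right 0)"
  obtains C where "\<And>h. 0 < h \<Longrightarrow> right_average g x h \<le> C"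
proof -
  define P where "P = enn2real (frac_potential \<alpha> g x)"
  have P: "frac_potential \<alpha> g x = ennreal P" "0 \<le> P" using fin by (auto simp: P_def)
  have far: "right_average g x h \<le> h powr - \<alpha> * P" if "0 < h" for h
  proof -
    have "enn2real (\<integral>\<^sup>+s\<in>{x<..<x + h}. ennreal (g s) \<partial>lborel) \<le> h powr (1 - \<alpha>) * P"
      using nn_integral_le_frac_potential[OF \<alpha>(2) g nonneg, of x h] P
      by (intro enn2real_leI) (auto simp: ennreal_mult')
    hence "right_average g x h \<le> h powr (1 - \<alpha>) * P / h"
      unfolding right_average_def using that by (intro divide_right_mono) auto
    also have "h powr (1 - \<alpha>) = h * h powr - \<alpha>"
      using powr_mult_base[of h "- \<alpha>"] that by simp
    finally show ?thesis using that by simp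
  qed
  from order_tendstoD(2)[OF lim, of "L + 1"]
  obtain d where d: "0 < d" "\<And>h. 0 < h \<Longrightarrow> h < d \<Longrightarrow> right_average g x h < L + 1"
    by (auto simp: eventually_at_right_field)
  show ?thesis
  proof (rule that[of "max (L + 1) (d powr - \<alpha> * P)"])
    fix h :: real assume h: "0 < h"
    show "right_average g x h \<le> max (L + 1) (d powr - \<alpha> * P)"
    proof (cases "h < d")
      case False
      hence "h powr - \<alpha> * P \<le> d powr - \<alpha> * P"
        using d \<alpha> P by (intro mult_right_mono powr_mono2') auto
      with far[OF h] show ?thesis by linarith
    qed (use d(2)[OF h] in linarith)
  qed
qed

lemma frac_approx_tendsto:
  assumes \<alpha>: "0 < \<alpha>" "\<alpha> < 1"
    and g [measurable]: "g \<in> borel_measurable borel" and nonneg: "\<And>s. 0 \<le> g s"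
    and fin: "frac_potential \<alpha> g x < \<infinity>"
    and lim: "(right_average g x \<longlongrightarrow> L) (at_right 0)"
  shows "((\<lambda>\<epsilon>. enn2real (frac_approx \<alpha> g x \<epsilon>)) \<longlongrightarrow> Gamma \<alpha> * Gamma (1 - \<alpha>) * L) (at_right 0)"
  \<comment> \<open>Dominated convergence concerns sequences, so the limit is tested along every
    positive null sequence.\<close>
  unfolding tendsto_at_iff_sequentially
proof (intro allI impI)
  fix X :: "nat \<Rightarrow> real"
  assume "\<forall>i. X i \<in> {0<..} - {0}" and X0: "X \<longlonglongrightarrow> 0"
  hence X: "0 < X i" for i by auto
  let ?a = "right_average g x" and ?m = "\<lambda>r. r * frac_kernel_density \<alpha> r"
  obtain C where C: "\<And>h. 0 < h \<Longrightarrow> ?a h \<le> C"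
    using right_average_bounded[OF assms] by blast
  have "0 \<le> L"
    using lim by (rule tendsto_lowerbound) (auto intro!: eventually_at_right_less eventually_mono[OF _ right_average_nonneg])
  have m: "0 \<le> ?m r" if "0 < r" for r
    using frac_kernel_density_nonneg[OF \<alpha> that] that by simp
  have scale: "ennreal (?m r * c) * indicator {0<..} r = ennreal c * (ennreal (?m r) * indicator {0<..} r)"
    if "0 \<le> c" for c r
    unfolding ennreal_mult''[OF that] by (simp only: mult_ac)
  have fin_avg: "(\<integral>\<^sup>+s\<in>{x<..<x + h}. ennreal (g s) \<partial>lborel) < \<infinity>" for h
    by (rule order.strict_trans1[OF nn_integral_le_frac_potential[OF \<alpha>(2) g nonneg]])
       (use fin in \<open>simp add: ennreal_mult_less_top\<close>)
  \<comment> \<open>Each integral over (x, x + \<epsilon> r) is the average times \<epsilon> r; the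
    factor \<epsilon> cancels and r joins m(r).\<close>
  have eq: "frac_approx \<alpha> g x \<epsilon> = (\<integral>\<^sup>+r. ennreal (?m r * ?a (\<epsilon> * r)) * indicator {0<..} r \<partial>lborel)"
    if "0 < \<epsilon>" for \<epsilon>
    unfolding frac_approx_eq_averages[OF \<alpha> that g nonneg]
  proof (intro nn_integral_cong)
    fix r
    show "ennreal (frac_kernel_density \<alpha> r / \<epsilon>) * (\<integral>\<^sup>+s\<in>{x<..<x + \<epsilon> * r}. ennreal (g s) \<partial>lborel) * indicator {0<..} r
        = ennreal (?m r * ?a (\<epsilon> * r)) * indicator {0<..} r"
    proof (cases "0 < r")
      case True
      have "(\<integral>\<^sup>+s\<in>{x<..<x + \<epsilon> * r}. ennreal (g s) \<partial>lborel) = ennreal (?a (\<epsilon> * r) * (\<epsilon> * r))"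
        using True that fin_avg[of "\<epsilon> * r"] by (simp add: right_average_def)
      hence "ennreal (frac_kernel_density \<alpha> r / \<epsilon>) * (\<integral>\<^sup>+s\<in>{x<..<x + \<epsilon> * r}. ennreal (g s) \<partial>lborel)
          = ennreal (frac_kernel_density \<alpha> r / \<epsilon> * (?a (\<epsilon> * r) * (\<epsilon> * r)))"
        using frac_kernel_density_nonneg[OF \<alpha> True] that by (simp only: ennreal_mult' divide_nonneg_pos)
      also have "frac_kernel_density \<alpha> r / \<epsilon> * (?a (\<epsilon> * r) * (\<epsilon> * r)) = ?m r * ?a (\<epsilon> * r)"
        using that by simp
      finally show ?thesis by simp
    qed simp
  qed
  have "(\<lambda>i. \<integral>\<^sup>+r. ennreal (?m r * ?a (X i * r)) * indicator {0<..} r \<partial>lborel) \<longlonglongrightarrow>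
      (\<integral>\<^sup>+r. ennreal (?m r * L) * indicator {0<..} r \<partial>lborel)"
  \<comment> \<open>The dominating function C r m(r) has integral C \<Gamma>(\<alpha>) \<Gamma>(1 -
    \<alpha>).\<close>
  proof (rule nn_integral_dominated_convergence[where w="\<lambda>r. ennreal (?m r * C) * indicator {0<..} r"])
    show "AE r in lborel. ennreal (?m r * ?a (X i * r)) * indicator {0<..} r \<le> ennreal (?m r * C) * indicator {0<..} r" for i
    proof (rule AE_I2)
      fix r
      show "ennreal (?m r * ?a (X i * r)) * indicator {0<..} r \<le> ennreal (?m r * C) * indicator {0<..} r"
        using C[of "X i * r"] X[of i] m[of r] by (auto intro!: ennreal_leI mult_left_mono split: split_indicator)
    qed
    have "0 \<le> C" using C[of 1] right_average_nonneg[of 1 g x] by linarith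
    hence "(\<integral>\<^sup>+r. ennreal (?m r * C) * indicator {0<..} r \<partial>lborel) =
        (\<integral>\<^sup>+r. ennreal C * (ennreal (?m r) * indicator {0<..} r) \<partial>lborel)"
      by (simp only: scale)
    also have "\<dots> = ennreal C * ennreal (Gamma \<alpha> * Gamma (1 - \<alpha>))"
      unfolding nn_integral_mult_frac_kernel_density[OF \<alpha>, symmetric]
      by (rule nn_integral_cmult) measurable
    finally show "(\<integral>\<^sup>+r. ennreal (?m r * C) * indicator {0<..} r \<partial>lborel) < \<infinity>"
      by (simp add: ennreal_mult_less_top)
    show "AE r in lborel. (\<lambda>i. ennreal (?m r * ?a (X i * r)) * indicator {0<..} r) \<longlonglongrightarrow> ennreal (?m r * L) * indicator {0<..} r"
    proof (rule AE_I2)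
      fix r :: real
      show "(\<lambda>i. ennreal (?m r * ?a (X i * r)) * indicator {0<..} r) \<longlonglongrightarrow> ennreal (?m r * L) * indicator {0<..} r"
      proof (cases "0 < r")
        case True
        \<comment> \<open>For fixed r the lengths X i r tend to 0 through positive values, so the
          averages tend to \<open>L\<close>.\<close>
        have "filterlim (\<lambda>i. X i * r) (at_right 0) sequentially"
          using True X tendsto_mult[OF X0 tendsto_const[of r]]
          by (auto simp: filterlim_at X[THEN less_imp_neq, symmetric] intro!: always_eventually)
        from filterlim_compose[OF lim this]
        have "(\<lambda>i. ennreal (?m r * ?a (X i * r))) \<longlonglongrightarrow> ennreal (?m r * L)"
          by (intro tendsto_intros)
        thus ?thesis using True by simp
      qed simp
    qed
  qed measurable
  also have "(\<integral>\<^sup>+r. ennreal (?m r * L) * indicator {0<..} r \<partial>lborel) =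
      (\<integral>\<^sup>+r. ennreal L * (ennreal (?m r) * indicator {0<..} r) \<partial>lborel)"
    using \<open>0 \<le> L\<close> by (simp only: scale)
  also have "\<dots> = ennreal L * ennreal (Gamma \<alpha> * Gamma (1 - \<alpha>))"
    unfolding nn_integral_mult_frac_kernel_density[OF \<alpha>, symmetric]
    by (rule nn_integral_cmult) measurable
  also have "\<dots> = ennreal (Gamma \<alpha> * Gamma (1 - \<alpha>) * L)"
    using \<open>0 \<le> L\<close> by (simp add: mult.commute flip: ennreal_mult')
  finally have "(\<lambda>i. frac_approx \<alpha> g x (X i)) \<longlonglongrightarrow> ennreal (Gamma \<alpha> * Gamma (1 - \<alpha>) * L)"
    by (simp add: eq X)
  from tendsto_enn2real[OF this]
  show "((\<lambda>\<epsilon>. enn2real (frac_approx \<alpha> g x \<epsilon>)) \<circ> X) \<longlonglongrightarrow> Gamma \<alpha> * Gamma (1 - \<alpha>) * L"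
    using \<open>0 \<le> L\<close> \<alpha> by (simp add: o_def Gamma_real_pos less_imp_le)
qed

text \<open>Finiteness of the potential at a point left of a compact interval makes g integrable on
  that interval; the Lebesgue differentiation theorem then applies.\<close>

lemma AE_right_average_tendsto:
  assumes \<alpha>: "0 < \<alpha>" "\<alpha> < 1"
    and g [measurable]: "g \<in> borel_measurable borel" and nonneg: "\<And>s. 0 \<le> g s"
    and fin: "AE x in lborel. frac_potential \<alpha> g x < \<infinity>"
  shows "AE x in lborel. (right_average g x \<longlongrightarrow> g x) (at_right 0)"
proof -
  have fin_Icc: "(\<integral>\<^sup>+s\<in>{a..b}. ennreal (g s) \<partial>lborel) < \<infinity>" for a b
  proof -
    \<comment> \<open>Otherwise an interval of length 1 would be a null set.\<close>
    have "\<exists>x\<in>{a - 1<..<a}. frac_potential \<alpha> g x < \<infinity>"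
    proof (rule ccontr)
      assume "\<not> ?thesis"
      with fin have "AE x in lborel. x \<notin> {a - 1<..<a}" by (auto elim!: eventually_mono)
      hence "emeasure lborel {a - 1<..<a} = 0"
        by (subst (asm) AE_iff_measurable[where N="{a - 1<..<a}"]) auto
      thus False by simp
    qed
    then obtain x where x: "x < a" "frac_potential \<alpha> g x < \<infinity>" by auto
    \<comment> \<open>The length b + 1 - x makes the open interval from x end beyond b.\<close>
    have "(\<integral>\<^sup>+s\<in>{a..b}. ennreal (g s) \<partial>lborel) \<le> (\<integral>\<^sup>+s\<in>{x<..<x + (b + 1 - x)}. ennreal (g s) \<partial>lborel)"
      using x by (intro nn_integral_mono) (auto split: split_indicator)
    also have "\<dots> \<le> ennreal ((b + 1 - x) powr (1 - \<alpha>)) * frac_potential \<alpha> g x"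
      by (rule nn_integral_le_frac_potential[OF \<alpha>(2) g nonneg])
    also have "\<dots> < \<infinity>" using x by (simp add: ennreal_mult_less_top)
    finally show ?thesis .
  qed
  have int: "set_integrable lborel {a..b} g" for a b
    unfolding set_integrable_def
  proof (rule integrableI_nonneg)
    have "(\<integral>\<^sup>+s. ennreal (indicat_real {a..b} s *\<^sub>R g s) \<partial>lborel) = (\<integral>\<^sup>+s\<in>{a..b}. ennreal (g s) \<partial>lborel)"
      by (intro nn_integral_cong) (auto split: split_indicator)
    with fin_Icc show "(\<integral>\<^sup>+s. ennreal (indicat_real {a..b} s *\<^sub>R g s) \<partial>lborel) < \<infinity>" by simp
  qed (use nonneg in auto)
  have avg: "right_average g x h = integral {x..x + h} g / h" if "0 < h" for x h
  proof -
    have "integral {x..x + h} g = (LINT s:{x..x + h}|lborel. g s)"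
      using set_borel_integral_eq_integral(2)[OF int] by simp
    also have "\<dots> = enn2real (\<integral>\<^sup>+s. ennreal (indicat_real {x..x + h} s *\<^sub>R g s) \<partial>lborel)"
      unfolding set_lebesgue_integral_def by (rule integral_eq_nn_integral) (use nonneg in auto)
    also have "(\<integral>\<^sup>+s. ennreal (indicat_real {x..x + h} s *\<^sub>R g s) \<partial>lborel) =
        (\<integral>\<^sup>+s\<in>{x<..<x + h}. ennreal (g s) \<partial>lborel)"
    proof (rule nn_integral_cong_AE)
      show "AE s in lborel. ennreal (indicat_real {x..x + h} s *\<^sub>R g s) = ennreal (g s) * indicator {x<..<x + h} s"
        using AE_lborel_singleton[of x] AE_lborel_singleton[of "x + h"]
        by eventually_elim (auto split: split_indicator)
    qed
    finally show ?thesis by (simp add: right_average_def)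
  qed
  have "g integrable_on cbox a b" for a b
    using set_borel_integral_eq_integral(1)[OF int] by simp
  then obtain N where N: "negligible N"
    "\<And>x e. x \<notin> N \<Longrightarrow> 0 < e \<Longrightarrow> \<exists>d>0. \<forall>h. 0 < h \<and> h < d \<longrightarrow>
        norm (integral (cbox x (x + h *\<^sub>R One)) g /\<^sub>R h ^ DIM(real) - g x) < e"
    by (rule integrable_ccontinuous_explicit) blast
  have "AE x in lebesgue. x \<notin> N"
    using N(1) by (intro AE_not_in) (simp add: negligible_iff_null_sets)
  hence "AE x in lborel. x \<notin> N" by (simp add: AE_completion_iff)
  thus ?thesis
  proof eventually_elim
    case (elim x)
    show ?case
    proof (rule tendstoI)
      fix e :: real assume "0 < e"
      from N(2)[OF elim this] obtain d where d: "0 < d"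
        "\<And>h. 0 < h \<Longrightarrow> h < d \<Longrightarrow> \<bar>integral {x..x + h} g / h - g x\<bar> < e"
        by (auto simp: divide_inverse mult.commute)
      show "\<forall>\<^sub>F h in at_right 0. dist (right_average g x h) (g x) < e"
        unfolding eventually_at_right_field using d by (auto simp: avg dist_real_def intro!: exI[of _ d])
    qed
  qed
qed


section \<open>From potentials to truncated derivatives of signed functions\<close>

text \<open>Finiteness of the potential at x permits subtraction in
  \<open>nn_integral_frac_potential_plus_approx\<close>, and the terms with u(t) and u(x) become
  separately integrable.\<close>

lemma frac_deriv_integral_potential:
  assumes \<alpha>: "0 < \<alpha>" "\<alpha> < 1" and \<epsilon>: "0 < \<epsilon>"
    and g [measurable]: "g \<in> borel_measurable borel" and nonneg: "\<And>s. 0 \<le> g s"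
    and fin: "AE t in lborel. frac_potential \<alpha> g t < \<infinity>" and finx: "frac_potential \<alpha> g x < \<infinity>"
  defines "u \<equiv> \<lambda>t. enn2real (frac_potential \<alpha> g t) / Gamma \<alpha>"
  shows "has_bochner_integral lborel (\<lambda>t. indicator {x + \<epsilon><..} t *\<^sub>R frac_deriv_integrand \<alpha> u x t)
           (- enn2real (frac_approx \<alpha> g x \<epsilon>) / (\<alpha> * Gamma \<alpha>))"
proof -
  let ?k = "\<lambda>t. 1 / (t - x) powr (1 + \<alpha>)"
  let ?Q = "\<integral>\<^sup>+t\<in>{x + \<epsilon><..}. frac_potential \<alpha> g t * ennreal (?k t) \<partial>lborel"
  define P where "P = enn2real (frac_potential \<alpha> g x)"
  define q where "q = enn2real ?Q"
  define j where "j = enn2real (frac_approx \<alpha> g x \<epsilon>)"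
  have P: "frac_potential \<alpha> g x = ennreal P" "0 \<le> P" using finx by (auto simp: P_def)
  note split = nn_integral_frac_potential_plus_approx[OF \<alpha> \<epsilon> g nonneg, of x]
  \<comment> \<open>The right side of the identity is finite, hence so is each summand on the
    left.\<close>
  have "?Q + ennreal (1 / \<alpha>) * frac_approx \<alpha> g x \<epsilon> < \<infinity>"
    unfolding split P by (simp add: ennreal_mult_less_top)
  hence "?Q < \<infinity>" "frac_approx \<alpha> g x \<epsilon> < \<infinity>"
    using \<alpha> by (auto simp: ennreal_mult_less_top)
  hence Q: "?Q = ennreal q" "0 \<le> q" and J: "frac_approx \<alpha> g x \<epsilon> = ennreal j" "0 \<le> j"
    by (auto simp: q_def j_def)
  have "ennreal (q + 1 / \<alpha> * j) = ennreal (\<epsilon> powr - \<alpha> / \<alpha> * P)"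
    using split \<alpha> Q(2) J(2) P(2) unfolding Q(1) J(1) P(1) by (simp flip: ennreal_mult' ennreal_plus)
  hence qj: "q + 1 / \<alpha> * j = \<epsilon> powr - \<alpha> / \<alpha> * P"
    using \<alpha> Q(2) J(2) P(2) by (subst (asm) ennreal_inj) auto
  have A: "has_bochner_integral lborel (\<lambda>t. indicator {x + \<epsilon><..} t * (enn2real (frac_potential \<alpha> g t) * ?k t)) q"
  proof (rule has_bochner_integral_nn_integral)
    have "(\<integral>\<^sup>+t. ennreal (indicator {x + \<epsilon><..} t * (enn2real (frac_potential \<alpha> g t) * ?k t)) \<partial>lborel) = ?Q"
    proof (rule nn_integral_cong_AE)
      \<comment> \<open>\<open>enn2real\<close> sends \<infinity> to 0, so the integrands are
        compared where the potential is finite.\<close>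
      show "AE t in lborel. ennreal (indicator {x + \<epsilon><..} t * (enn2real (frac_potential \<alpha> g t) * ?k t)) =
          frac_potential \<alpha> g t * ennreal (?k t) * indicator {x + \<epsilon><..} t"
        using fin
      proof eventually_elim
        case (elim t)
        thus ?case
          by (auto simp: ennreal_mult' ennreal_enn2real_if less_top split: split_indicator simp del: times_divide_eq_right)
      qed
    qed
    thus "(\<integral>\<^sup>+t. ennreal (indicator {x + \<epsilon><..} t * (enn2real (frac_potential \<alpha> g t) * ?k t)) \<partial>lborel) = ennreal q"
      by (simp add: Q(1))
  qed (use Q(2) in auto)
  have B: "has_bochner_integral lborel (\<lambda>t. indicator {x + \<epsilon><..} t * ?k t) (\<epsilon> powr - \<alpha> / \<alpha>)"
  proof (rule has_bochner_integral_nn_integral)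
    have "(\<integral>\<^sup>+t. ennreal (indicator {x + \<epsilon><..} t * ?k t) \<partial>lborel) = (\<integral>\<^sup>+t\<in>{x + \<epsilon><..}. ennreal (?k t) \<partial>lborel)"
      by (intro nn_integral_cong) (auto split: split_indicator)
    thus "(\<integral>\<^sup>+t. ennreal (indicator {x + \<epsilon><..} t * ?k t) \<partial>lborel) = ennreal (\<epsilon> powr - \<alpha> / \<alpha>)"
      by (simp only: nn_integral_powr_Ioi[OF \<alpha>(1) \<epsilon>])
  qed (use \<alpha> in auto)
  have "has_bochner_integral lborel
      (\<lambda>t. 1 / Gamma \<alpha> * (indicator {x + \<epsilon><..} t * (enn2real (frac_potential \<alpha> g t) * ?k t)) -
         u x * (indicator {x + \<epsilon><..} t * ?k t)) (1 / Gamma \<alpha> * q - u x * (\<epsilon> powr - \<alpha> / \<alpha>))"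
    by (intro has_bochner_integral_diff has_bochner_integral_mult_right A B)
  also have "(\<lambda>t. 1 / Gamma \<alpha> * (indicator {x + \<epsilon><..} t * (enn2real (frac_potential \<alpha> g t) * ?k t)) -
         u x * (indicator {x + \<epsilon><..} t * ?k t)) =
      (\<lambda>t. indicator {x + \<epsilon><..} t *\<^sub>R frac_deriv_integrand \<alpha> u x t)"
    by (intro ext) (auto simp: frac_deriv_integrand_def u_def diff_divide_distrib split: split_indicator)
  also have "1 / Gamma \<alpha> * q - u x * (\<epsilon> powr - \<alpha> / \<alpha>) = (q - \<epsilon> powr - \<alpha> / \<alpha> * P) / Gamma \<alpha>"
    by (simp add: u_def P_def diff_divide_distrib mult.commute)
  also have "\<dots> = - j / (\<alpha> * Gamma \<alpha>)"
    using qj[symmetric] by simp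
  finally show ?thesis by (simp add: j_def)
qed

text \<open>The integral ignores null sets, so the equality holds at every point. A Borel
  representative may thus replace f inside the derivative, which also evaluates the fractional
  integral at x itself.\<close>

lemma frac_integral_AE_cong:
  assumes "f \<in> borel_measurable lebesgue" "F \<in> borel_measurable borel" "AE x in lebesgue. f x = F x"
  shows "frac_integral \<alpha> f = frac_integral \<alpha> F"
proof
  fix x
  have [measurable]: "F \<in> borel_measurable lebesgue"
    using assms(2) by (simp add: measurable_completion)
  have [measurable]: "(\<lambda>t. 1 / (t - x) powr (1 - \<alpha>)) \<in> borel_measurable lebesgue" "(\<lambda>t. indicat_real {x<..} t) \<in> borel_measurable lebesgue"
    by (rule measurable_completion, measurable)+
  have "(\<lambda>t. indicat_real {x<..} t * (f t * (1 / (t - x) powr (1 - \<alpha>)))) \<in> borel_measurable lebesgue"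
    "(\<lambda>t. indicat_real {x<..} t * (F t * (1 / (t - x) powr (1 - \<alpha>)))) \<in> borel_measurable lebesgue"
    using assms(1) by measurable
  thus "frac_integral \<alpha> f x = frac_integral \<alpha> F x"
    unfolding frac_integral_def set_lebesgue_integral_def
    by (intro arg_cong2[where f="(*)"] refl integral_cong_AE) (use assms(3) in auto)
qed

text \<open>The kernel is nonnegative, so the positive and negative parts of the integrand come from
  those of \<open>F\<close>; absolute convergence allows the splitting.\<close>

lemma frac_integral_eq_diff_potential:
  assumes \<alpha>: "0 < \<alpha>" and F [measurable]: "F \<in> borel_measurable borel"
    and fin: "frac_potential \<alpha> (\<lambda>s. \<bar>F s\<bar>) x < \<infinity>"
  shows "frac_integral \<alpha> F x = enn2real (frac_potential \<alpha> (\<lambda>s. max 0 (F s)) x) / Gamma \<alpha>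
      - enn2real (frac_potential \<alpha> (\<lambda>s. max 0 (- F s)) x) / Gamma \<alpha>"
proof -
  let ?f = "\<lambda>t. indicat_real {x<..} t *\<^sub>R (F t / (t - x) powr (1 - \<alpha>))"
  have "(\<integral>\<^sup>+t. ennreal (norm (?f t)) \<partial>lborel) = frac_potential \<alpha> (\<lambda>s. \<bar>F s\<bar>) x"
    unfolding frac_potential_def by (intro nn_integral_cong) (auto split: split_indicator simp: abs_mult)
  with fin have int: "integrable lborel ?f"
    by (intro integrableI_bounded) auto
  \<comment> \<open>\<open>ennreal\<close> maps negative reals to 0 and so takes the positive
    part.\<close>
  have pos: "(\<integral>\<^sup>+t. ennreal (?f t) \<partial>lborel) = frac_potential \<alpha> (\<lambda>s. max 0 (F s)) x"
    unfolding frac_potential_def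
    by (intro nn_integral_cong) (auto split: split_indicator simp: max_def ennreal_neg divide_nonpos_nonneg)
  have neg: "(\<integral>\<^sup>+t. ennreal (- ?f t) \<partial>lborel) = frac_potential \<alpha> (\<lambda>s. max 0 (- F s)) x"
    unfolding frac_potential_def
    by (intro nn_integral_cong) (auto split: split_indicator simp: max_def ennreal_neg divide_nonneg_nonneg)
  have "frac_integral \<alpha> F x = 1 / Gamma \<alpha> * integral\<^sup>L lborel ?f"
    unfolding frac_integral_def set_lebesgue_integral_def by (subst integral_completion) auto
  thus ?thesis
    unfolding real_lebesgue_integral_def[OF int] pos neg by (simp add: diff_divide_distrib)
qed

text \<open>The nonnegative case is applied to the positive and negative parts of \<open>F\<close>,
  whose potentials are dominated by that of \<bar>F\<bar>.\<close>

lemma AE_frac_deriv_right_trunc_tendsto: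
  fixes F :: "real \<Rightarrow> real"
  assumes \<alpha>: "0 < \<alpha>" "\<alpha> < 1" and F [measurable]: "F \<in> borel_measurable borel"
    and fin: "AE x in lborel. frac_potential \<alpha> (\<lambda>s. \<bar>F s\<bar>) x < \<infinity>"
  shows "AE x in lborel.
      (\<forall>\<epsilon>>0. set_integrable lebesgue {x + \<epsilon><..} (frac_deriv_integrand \<alpha> (frac_integral \<alpha> F) x)) \<and>
      ((\<lambda>\<epsilon>. frac_deriv_right_trunc \<alpha> \<epsilon> (frac_integral \<alpha> F) x) \<longlongrightarrow> F x) (at_right 0)"
proof -
  define g1 g2 where "g1 = (\<lambda>s. max 0 (F s))" and "g2 = (\<lambda>s. max 0 (- F s))"
  have [measurable]: "g1 \<in> borel_measurable borel" "g2 \<in> borel_measurable borel"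
    unfolding g1_def g2_def by measurable
  have nonneg: "0 \<le> g1 s" "0 \<le> g2 s" for s by (auto simp: g1_def g2_def)
  have le: "frac_potential \<alpha> g1 x \<le> frac_potential \<alpha> (\<lambda>s. \<bar>F s\<bar>) x"
    "frac_potential \<alpha> g2 x \<le> frac_potential \<alpha> (\<lambda>s. \<bar>F s\<bar>) x" for x
    unfolding frac_potential_def
    by (intro nn_integral_mono mult_right_mono ennreal_leI divide_right_mono; simp add: g1_def g2_def)+
  define u1 u2 where "u1 = (\<lambda>t. enn2real (frac_potential \<alpha> g1 t) / Gamma \<alpha>)"
    and "u2 = (\<lambda>t. enn2real (frac_potential \<alpha> g2 t) / Gamma \<alpha>)"
  let ?U = "frac_integral \<alpha> F"
  have U: "?U t = u1 t - u2 t" if "frac_potential \<alpha> (\<lambda>s. \<bar>F s\<bar>) t < \<infinity>" for t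
    using frac_integral_eq_diff_potential[OF \<alpha>(1) F that] by (simp add: u1_def u2_def g1_def g2_def)
  have [measurable]: "?U \<in> borel_measurable borel"
  proof -
    have "?U = (\<lambda>x. 1 / Gamma \<alpha> * (LINT t|lborel. (if x < t then F t / (t - x) powr (1 - \<alpha>) else 0)))"
    proof
      fix x
      have "?U x = 1 / Gamma \<alpha> * (LINT t|lborel. indicat_real {x<..} t *\<^sub>R (F t / (t - x) powr (1 - \<alpha>)))"
        unfolding frac_integral_def set_lebesgue_integral_def by (subst integral_completion) auto
      also have "(LINT t|lborel. indicat_real {x<..} t *\<^sub>R (F t / (t - x) powr (1 - \<alpha>))) =
          (LINT t|lborel. (if x < t then F t / (t - x) powr (1 - \<alpha>) else 0))"
        by (intro Bochner_Integration.integral_cong) auto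
      finally show "?U x = 1 / Gamma \<alpha> * (LINT t|lborel. (if x < t then F t / (t - x) powr (1 - \<alpha>) else 0))" .
    qed
    also have "\<dots> \<in> borel_measurable borel" by measurable
    finally show ?thesis .
  qed
  have fin1: "AE x in lborel. frac_potential \<alpha> g1 x < \<infinity>" and fin2: "AE x in lborel. frac_potential \<alpha> g2 x < \<infinity>"
    using fin by (eventually_elim, use le order.strict_trans1 in blast)+
  note leb1 = AE_right_average_tendsto[OF \<alpha> _ _ fin1] and leb2 = AE_right_average_tendsto[OF \<alpha> _ _ fin2]
  have "AE x in lborel. (right_average g1 x \<longlongrightarrow> g1 x) (at_right 0)"
    "AE x in lborel. (right_average g2 x \<longlongrightarrow> g2 x) (at_right 0)"
    using nonneg by (intro leb1 leb2; simp)+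
  with fin show ?thesis
  proof eventually_elim
    case (elim x)
    have finx: "frac_potential \<alpha> g1 x < \<infinity>" "frac_potential \<alpha> g2 x < \<infinity>"
      using le[of x] elim(1) by (auto intro: order.strict_trans1)
    define j where "j = (\<lambda>\<epsilon>. enn2real (frac_approx \<alpha> g1 x \<epsilon>) - enn2real (frac_approx \<alpha> g2 x \<epsilon>))"
    have bochner: "has_bochner_integral lborel
        (\<lambda>t. indicator {x + \<epsilon><..} t *\<^sub>R frac_deriv_integrand \<alpha> ?U x t) (- j \<epsilon> / (\<alpha> * Gamma \<alpha>))" if \<epsilon>: "0 < \<epsilon>" for \<epsilon>
    proof -
      have D: "has_bochner_integral lborel
          (\<lambda>t. indicator {x + \<epsilon><..} t *\<^sub>R frac_deriv_integrand \<alpha> u1 x t - indicator {x + \<epsilon><..} t *\<^sub>R frac_deriv_integrand \<alpha> u2 x t)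
          (- enn2real (frac_approx \<alpha> g1 x \<epsilon>) / (\<alpha> * Gamma \<alpha>) - (- enn2real (frac_approx \<alpha> g2 x \<epsilon>) / (\<alpha> * Gamma \<alpha>)))"
        unfolding u1_def u2_def
        by (intro has_bochner_integral_diff frac_deriv_integral_potential) (use \<alpha> \<epsilon> nonneg fin1 fin2 finx in auto)
      \<comment> \<open>The splitting of the fractional integral enters at the fixed x as well as at
        almost every t.\<close>
      have E: "AE t in lborel. indicator {x + \<epsilon><..} t *\<^sub>R frac_deriv_integrand \<alpha> u1 x t -
          indicator {x + \<epsilon><..} t *\<^sub>R frac_deriv_integrand \<alpha> u2 x t = indicator {x + \<epsilon><..} t *\<^sub>R frac_deriv_integrand \<alpha> ?U x t"
        using fin
      proof eventually_elim
        case (elim t)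
        thus ?case
          using U[OF elim] U[OF \<open>frac_potential \<alpha> (\<lambda>s. \<bar>F s\<bar>) x < \<infinity>\<close>]
          by (simp add: frac_deriv_integrand_def split: split_indicator flip: diff_divide_distrib)
      qed
      have M: "(\<lambda>t. indicator {x + \<epsilon><..} t *\<^sub>R frac_deriv_integrand \<alpha> ?U x t) \<in> borel_measurable lborel"
        unfolding frac_deriv_integrand_def by measurable
      have "has_bochner_integral lborel (\<lambda>t. indicator {x + \<epsilon><..} t *\<^sub>R frac_deriv_integrand \<alpha> ?U x t)
          (- enn2real (frac_approx \<alpha> g1 x \<epsilon>) / (\<alpha> * Gamma \<alpha>) - (- enn2real (frac_approx \<alpha> g2 x \<epsilon>) / (\<alpha> * Gamma \<alpha>)))"
        using has_bochner_integral_cong_AE[OF borel_measurable_has_bochner_integral[OF D] M E] D by blast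
      thus ?thesis by (simp add: j_def diff_divide_distrib)
    qed
    have int: "integrable lborel (\<lambda>t. indicator {x + \<epsilon><..} t *\<^sub>R frac_deriv_integrand \<alpha> ?U x t)" if "0 < \<epsilon>" for \<epsilon>
      using bochner[OF that] by (simp add: has_bochner_integral_iff)
    \<comment> \<open>The functional equation at -\<alpha>, which lies strictly between -1 and 0 and
      so is not a pole, converts the normalisation 1 / \<Gamma>(-\<alpha>) into 1 / \<Gamma>(1 -
      \<alpha>).\<close>
    have Gamma_reflect: "Gamma (1 - \<alpha>) = - \<alpha> * Gamma (- \<alpha>)"
    proof -
      have "- \<alpha> \<notin> \<int>\<^sub>\<le>\<^sub>0"
      proof
        assume "- \<alpha> \<in> \<int>\<^sub>\<le>\<^sub>0"
        then obtain n :: int where "- \<alpha> = of_int n" by (auto elim: nonpos_Ints_cases)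
        with \<alpha> have "-1 < n" "n < 0" by linarith+
        thus False by simp
      qed
      from Gamma_plus1[OF this] show ?thesis by simp
    qed
    have G: "0 < Gamma \<alpha>" "0 < Gamma (1 - \<alpha>)" using \<alpha> by (auto intro: Gamma_real_pos)
    have trunc: "frac_deriv_right_trunc \<alpha> \<epsilon> ?U x = j \<epsilon> / (Gamma \<alpha> * Gamma (1 - \<alpha>))" if "0 < \<epsilon>" for \<epsilon>
    proof -
      have "frac_deriv_right_trunc \<alpha> \<epsilon> ?U x =
          1 / Gamma (- \<alpha>) * (LINT t|lborel. indicator {x + \<epsilon><..} t *\<^sub>R frac_deriv_integrand \<alpha> ?U x t)"
        unfolding frac_deriv_right_trunc_def set_lebesgue_integral_def
        by (subst integral_completion) (use int[OF that] in auto)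
      also have "\<dots> = 1 / Gamma (- \<alpha>) * (- j \<epsilon> / (\<alpha> * Gamma \<alpha>))"
        using bochner[OF that] by (simp add: has_bochner_integral_iff)
      also have "\<dots> = j \<epsilon> / (Gamma \<alpha> * Gamma (1 - \<alpha>))"
        unfolding Gamma_reflect using \<alpha> by (simp add: field_simps)
      finally show ?thesis .
    qed
    have "(j \<longlongrightarrow> Gamma \<alpha> * Gamma (1 - \<alpha>) * g1 x - Gamma \<alpha> * Gamma (1 - \<alpha>) * g2 x) (at_right 0)"
      unfolding j_def by (intro tendsto_diff frac_approx_tendsto) (use \<alpha> nonneg finx elim in auto)
    hence "((\<lambda>\<epsilon>. j \<epsilon> / (Gamma \<alpha> * Gamma (1 - \<alpha>))) \<longlongrightarrow>
        (Gamma \<alpha> * Gamma (1 - \<alpha>) * g1 x - Gamma \<alpha> * Gamma (1 - \<alpha>) * g2 x) / (Gamma \<alpha> * Gamma (1 - \<alpha>))) (at_right 0)"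
      by (rule tendsto_divide[OF _ tendsto_const]) (use G in simp)
    also have "(Gamma \<alpha> * Gamma (1 - \<alpha>) * g1 x - Gamma \<alpha> * Gamma (1 - \<alpha>) * g2 x) / (Gamma \<alpha> * Gamma (1 - \<alpha>)) = g1 x - g2 x"
      using G by (simp add: field_simps)
    also have "g1 x - g2 x = F x" by (simp add: g1_def g2_def max_def)
    finally have "((\<lambda>\<epsilon>. frac_deriv_right_trunc \<alpha> \<epsilon> ?U x) \<longlongrightarrow> F x) (at_right 0)"
      by (rule Lim_transform_eventually) (use trunc in \<open>auto simp: eventually_at_right_field intro: exI[of _ 1]\<close>)
    moreover have "set_integrable lebesgue {x + \<epsilon><..} (frac_deriv_integrand \<alpha> ?U x)" if "0 < \<epsilon>" for \<epsilon>
      unfolding set_integrable_def using int[OF that] by (simp add: integrable_completion)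
    ultimately show ?case by blast
  qed
qed

text \<open>The integrability clause of the conclusion ensures that the truncated derivatives are
  genuine integrals and not the default value 0 of the Bochner integral.\<close>

theorem theorem1p5:
  fixes \<alpha> p q p' :: real and w :: "real \<Rightarrow> real"
  assumes "0 < \<alpha>" and "\<alpha> < 1"
    and "1 < p" and "p < 1 / \<alpha>"
    and "1 / q = 1 / p - \<alpha>"
    and "p' = p / (p - 1)"
    and "w \<in> borel_measurable lebesgue"
    and "\<And>x. 0 \<le> w x"
    and "locally_integrable_ennreal (\<lambda>x. ennreal (w x powr p))"
    and "locally_integrable_ennreal (\<lambda>x. inverse (ennreal (w x powr p')))"
    and "\<And>f. \<lbrakk>f \<in> Lp_space (weight_measure w p) p; \<And>x. 0 \<le> f x\<rbrakk>
           \<Longrightarrow> AE x in lebesgue. frac_integral_ennreal \<alpha> f x < \<infinity>"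
  shows "\<forall>f \<in> Lp_space (weight_measure w p) p. AE x in lebesgue.
           (\<forall>\<epsilon>>0. set_integrable lebesgue {x + \<epsilon><..}
                     (frac_deriv_integrand \<alpha> (frac_integral \<alpha> f) x)) \<and>
           ((\<lambda>\<epsilon>. frac_deriv_right_trunc \<alpha> \<epsilon> (frac_integral \<alpha> f) x) \<longlongrightarrow> f x) (at_right 0) \<and>
           f x = frac_deriv_right \<alpha> (frac_integral \<alpha> f) x"
proof
  fix f assume f: "f \<in> Lp_space (weight_measure w p) p"
  hence f_meas: "f \<in> borel_measurable lebesgue"
    by (simp add: Lp_space_def weight_measure_def)
  \<comment> \<open>The interchange results concern Borel functions, so f is replaced by a Borel
    representative.\<close>
  from completion_ex_borel_measurable_real[OF f_meas]
  obtain F where F [measurable]: "F \<in> borel_measurable borel" and AE_F: "AE x in lborel. f x = F x" by auto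
  hence AE_F': "AE x in lebesgue. f x = F x" by (simp add: AE_completion)
  \<comment> \<open>The finiteness hypothesis at \<bar>f\<bar> gives absolute convergence for the
    signed f.\<close>
  have "(\<lambda>x. \<bar>f x\<bar>) \<in> Lp_space (weight_measure w p) p"
    using f by (auto simp: Lp_space_def)
  hence "AE x in lebesgue. frac_integral_ennreal \<alpha> (\<lambda>x. \<bar>f x\<bar>) x < \<infinity>"
    by (rule assms(11)) simp
  moreover have "frac_integral_ennreal \<alpha> (\<lambda>x. \<bar>f x\<bar>) x = ennreal (1 / Gamma \<alpha>) * frac_potential \<alpha> (\<lambda>s. \<bar>F s\<bar>) x" for x
    unfolding frac_integral_ennreal_def frac_potential_def nn_integral_completion
    by (intro arg_cong2[where f="(*)"] refl nn_integral_cong_AE) (use AE_F in auto)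
  ultimately have "AE x in lborel. frac_potential \<alpha> (\<lambda>s. \<bar>F s\<bar>) x < \<infinity>"
    using Gamma_real_pos[OF assms(1)] by (auto simp: AE_completion_iff ennreal_mult_less_top)
  from AE_completion[OF AE_frac_deriv_right_trunc_tendsto[OF assms(1,2) F this]] AE_F'
  show "AE x in lebesgue.
           (\<forall>\<epsilon>>0. set_integrable lebesgue {x + \<epsilon><..}
                     (frac_deriv_integrand \<alpha> (frac_integral \<alpha> f) x)) \<and>
           ((\<lambda>\<epsilon>. frac_deriv_right_trunc \<alpha> \<epsilon> (frac_integral \<alpha> f) x) \<longlongrightarrow> f x) (at_right 0) \<and>
           f x = frac_deriv_right \<alpha> (frac_integral \<alpha> f) x"
    unfolding frac_integral_AE_cong[OF f_meas F AE_F']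
  proof eventually_elim
    case (elim x)
    thus ?case
      \<comment> \<open>Uniqueness of limits along \<open>at_right 0\<close> identifies
        \<open>Lim\<close> with the limit just obtained.\<close>
      by (auto simp: frac_deriv_right_def intro!: tendsto_Lim[symmetric])
  qed
qed

end
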